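(* Let $d\ge 1$ be such that the Zakharov system below is considered on $\mathbb{T}^d$, and let $s<\frac{d-3}{2}$. Then for any $T>0$, the data-to-solution map $(u_0,n_0,n_1)\mapsto (u,n,\partial_t n)$ of the periodic Zakharov system $$i\partial_t u+\Delta u=nu,\qquad \partial_t^2 n-\Delta n=\Delta(|u|^2),\qquad (u(0),n(0),\partial_t n(0))=(u_0,n_0,n_1),$$ as a map from the unit ball in $\mathcal{H}^{s,s-\frac12}(\mathbb{T}^d)$ to $C([0,T];\mathcal{H}^{s,s-\frac12}(\mathbb{T}^d))$, fails to be $C^2$-differentiable at the origin.
   Context: $\mathbb{T}^d=(\mathbb{R}/2\pi\mathbb{Z})^d$; $u$ is complex-valued and $n$ real-valued; $\mathcal{H}^{s,\ell}(\mathbb{T}^d):=H^s(\mathbb{T}^d)\times H^{\ell}(\mathbb{T}^d)\times H^{\ell-1}(\mathbb{T}^d)$ with $H^s$ the $L^2$-based Sobolev space. *)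

theory Defs
  imports "HOL-Analysis.Analysis"
begin

text \<open>Functions on the torus T^d = (R/2piZ)^d are represented by their Fourier
coefficients, indexed by the lattice Z^d (= int ^ 'd, with d = CARD('d)).
A data triple (u, n, n_t) is a triple of coefficient functions.\<close>

type_synonym 'd fc = "int ^ 'd \<Rightarrow> complex"
type_synonym 'd dat = "'d fc \<times> 'd fc \<times> 'd fc"
type_synonym 'd traj = "real \<Rightarrow> 'd dat"

definition ksq :: "int ^ ('d::finite) \<Rightarrow> real" where
  "ksq k = (\<Sum>i\<in>UNIV. (real_of_int (k $ i))\<^sup>2)"

definition in_sob :: "real \<Rightarrow> ('d::finite) fc \<Rightarrow> bool" where
  "in_sob s f \<longleftrightarrow> (\<lambda>k. (1 + ksq k) powr s * (cmod (f k))\<^sup>2) summable_on UNIV"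

definition sob_nsq :: "real \<Rightarrow> ('d::finite) fc \<Rightarrow> real" where
  "sob_nsq s f = (\<Sum>\<^sub>\<infinity>k. (1 + ksq k) powr s * (cmod (f k))\<^sup>2)"

text \<open>real-valuedness of the function with Fourier coefficients f\<close>
definition real_fc :: "('d::finite) fc \<Rightarrow> bool" where
  "real_fc f \<longleftrightarrow> (\<forall>k. f (- k) = cnj (f k))"

definition Hsp :: "real \<Rightarrow> real \<Rightarrow> ('d::finite) dat set" where
  "Hsp s l = {(u, n0, n1). in_sob s u \<and> in_sob l n0 \<and> in_sob (l - 1) n1 \<and> real_fc n0 \<and> real_fc n1}"

definition Hnorm :: "real \<Rightarrow> real \<Rightarrow> ('d::finite) dat \<Rightarrow> real" where
  "Hnorm s l x = sqrt (sob_nsq s (fst x) + sob_nsq l (fst (snd x)) + sob_nsq (l - 1) (snd (snd x)))"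

definition dadd :: "('d::finite) dat \<Rightarrow> 'd dat \<Rightarrow> 'd dat" where
  "dadd x y = ((\<lambda>k. fst x k + fst y k), (\<lambda>k. fst (snd x) k + fst (snd y) k),
               (\<lambda>k. snd (snd x) k + snd (snd y) k))"

definition dscale :: "real \<Rightarrow> ('d::finite) dat \<Rightarrow> 'd dat" where
  "dscale a x = ((\<lambda>k. of_real a * fst x k), (\<lambda>k. of_real a * fst (snd x) k),
                 (\<lambda>k. of_real a * snd (snd x) k))"

definition dsub :: "('d::finite) dat \<Rightarrow> 'd dat \<Rightarrow> 'd dat" where
  "dsub x y = dadd x (dscale (-1) y)"

definition dzero :: "('d::finite) dat" where
  "dzero = ((\<lambda>k. 0), (\<lambda>k. 0), (\<lambda>k. 0))"

definition CT :: "real \<Rightarrow> real \<Rightarrow> real \<Rightarrow> ('d::finite) traj set" where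
  "CT T s l = {U. (\<forall>t\<in>{0..T}. U t \<in> Hsp s l) \<and>
      (\<forall>t\<in>{0..T}. \<forall>\<epsilon>>0. \<exists>\<delta>>0. \<forall>t'\<in>{0..T}. \<bar>t' - t\<bar> < \<delta> \<longrightarrow> Hnorm s l (dsub (U t') (U t)) < \<epsilon>)}"

definition CTnorm :: "real \<Rightarrow> real \<Rightarrow> real \<Rightarrow> ('d::finite) traj \<Rightarrow> real" where
  "CTnorm T s l U = (SUP t\<in>{0..T}. Hnorm s l (U t))"

definition bdd_lin :: "real \<Rightarrow> real \<Rightarrow> real \<Rightarrow> (('d::finite) dat \<Rightarrow> 'd traj) \<Rightarrow> bool" where
  "bdd_lin T s l L \<longleftrightarrow>
     (\<forall>x\<in>Hsp s l. L x \<in> CT T s l) \<and>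
     (\<forall>x\<in>Hsp s l. \<forall>y\<in>Hsp s l. \<forall>a b. \<forall>t\<in>{0..T}.
         L (dadd (dscale a x) (dscale b y)) t = dadd (dscale a (L x t)) (dscale b (L y t))) \<and>
     (\<exists>C. \<forall>x\<in>Hsp s l. CTnorm T s l (L x) \<le> C * Hnorm s l x)"

definition bdd_bilin :: "real \<Rightarrow> real \<Rightarrow> real \<Rightarrow> (('d::finite) dat \<Rightarrow> 'd dat \<Rightarrow> 'd traj) \<Rightarrow> bool" where
  "bdd_bilin T s l B \<longleftrightarrow>
     (\<forall>x\<in>Hsp s l. bdd_lin T s l (B x)) \<and>
     (\<forall>h\<in>Hsp s l. bdd_lin T s l (\<lambda>x. B x h)) \<and>
     (\<exists>C. \<forall>x\<in>Hsp s l. \<forall>h\<in>Hsp s l. CTnorm T s l (B x h) \<le> C * Hnorm s l x * Hnorm s l h)"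

definition uball :: "real \<Rightarrow> real \<Rightarrow> ('d::finite) dat set" where
  "uball s l = {x \<in> Hsp s l. Hnorm s l x < 1}"

definition frechet_at :: "real \<Rightarrow> real \<Rightarrow> real \<Rightarrow> (('d::finite) dat \<Rightarrow> 'd traj) \<Rightarrow> ('d dat \<Rightarrow> 'd traj) \<Rightarrow> 'd dat \<Rightarrow> bool" where
  "frechet_at T s l S L x \<longleftrightarrow> bdd_lin T s l L \<and>
     (\<forall>\<epsilon>>0. \<exists>\<delta>>0. \<forall>y\<in>uball s l. Hnorm s l (dsub y x) < \<delta> \<longrightarrow>
        CTnorm T s l (\<lambda>t. dsub (dsub (S y t) (S x t)) (L (dsub y x) t)) \<le> \<epsilon> * Hnorm s l (dsub y x))"

definition twice_frechet_at0 :: "real \<Rightarrow> real \<Rightarrow> real \<Rightarrow> (('d::finite) dat \<Rightarrow> 'd traj) \<Rightarrow> bool" where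
  "twice_frechet_at0 T s l S \<longleftrightarrow>
     (\<exists>r>0. r \<le> 1 \<and> (\<exists>D B.
        (\<forall>x\<in>Hsp s l. Hnorm s l x < r \<longrightarrow> frechet_at T s l S (D x) x) \<and>
        bdd_bilin T s l B \<and>
        (\<forall>\<epsilon>>0. \<exists>\<delta>>0. \<forall>x\<in>Hsp s l. Hnorm s l x < \<delta> \<longrightarrow>
           (\<forall>h\<in>Hsp s l. CTnorm T s l (\<lambda>t. dsub (dsub (D x h t) (D dzero h t)) (B x h t))
                            \<le> \<epsilon> * Hnorm s l x * Hnorm s l h))))"

definition smooth_dat :: "('d::finite) dat \<Rightarrow> bool" where
  "smooth_dat x \<longleftrightarrow> (\<forall>\<sigma>. in_sob \<sigma> (fst x) \<and> in_sob \<sigma> (fst (snd x)) \<and> in_sob \<sigma> (snd (snd x)))"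

text \<open>Classical (smooth) solution on [0,T] of the periodic Zakharov system
  i u_t + Lap u = n u,  n_tt - Lap n = Lap(|u|^2),
written as a first-order system for (u, n, m = n_t) on Fourier coefficients:
  u_t(k) = -i (|k|^2 u(k) + sum_j n(j) u(k-j)),
  n_t(k) = m(k),
  m_t(k) = -|k|^2 n(k) - |k|^2 sum_j u(j) conj(u(j-k)).\<close>
definition classical_sol :: "real \<Rightarrow> ('d::finite) dat \<Rightarrow> 'd traj \<Rightarrow> bool" where
  "classical_sol T \<phi> U \<longleftrightarrow>
     U 0 = \<phi> \<and>
     (\<forall>\<sigma>. \<exists>C. \<forall>t\<in>{0..T}.
        in_sob \<sigma> (fst (U t)) \<and> in_sob \<sigma> (fst (snd (U t))) \<and> in_sob \<sigma> (snd (snd (U t))) \<and>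
        sob_nsq \<sigma> (fst (U t)) + sob_nsq \<sigma> (fst (snd (U t))) + sob_nsq \<sigma> (snd (snd (U t))) \<le> C) \<and>
     (\<forall>t\<in>{0..T}. real_fc (fst (snd (U t))) \<and> real_fc (snd (snd (U t)))) \<and>
     (\<forall>k. \<forall>t\<in>{0..T}.
        ((\<lambda>\<tau>. fst (U \<tau>) k) has_vector_derivative
            (- \<i> * (of_real (ksq k) * fst (U t) k
                    + (\<Sum>\<^sub>\<infinity>j. fst (snd (U t)) j * fst (U t) (k - j))))) (at t within {0..T}) \<and>
        ((\<lambda>\<tau>. fst (snd (U \<tau>)) k) has_vector_derivative snd (snd (U t)) k) (at t within {0..T}) \<and>
        ((\<lambda>\<tau>. snd (snd (U \<tau>)) k) has_vector_derivative
            (- of_real (ksq k) * fst (snd (U t)) k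
             - of_real (ksq k) * (\<Sum>\<^sub>\<infinity>j. fst (U t) j * cnj (fst (U t) (j - k))))) (at t within {0..T}))"

definition data_to_sol :: "real \<Rightarrow> real \<Rightarrow> real \<Rightarrow> (('d::finite) dat \<Rightarrow> 'd traj) \<Rightarrow> bool" where
  "data_to_sol T s l S \<longleftrightarrow>
     (\<forall>\<phi>\<in>uball s l. S \<phi> \<in> CT T s l) \<and>
     (\<forall>\<phi>\<in>uball s l. smooth_dat \<phi> \<longrightarrow>
        (\<forall>U. classical_sol T \<phi> U \<longrightarrow> (\<forall>t\<in>{0..T}. S \<phi> t = U t)))"

end

theory Submission
  imports Defs
begin

text \<open>Take data \<open>(\<epsilon> u0, 0, 0)\<close> where \<open>u0\<close> has nonnegative Fourier coefficients supported in a
cube of side comparable to \<open>N\<close> at distance comparable to \<open>N\<close> from the origin. The order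
\<open>\<epsilon>\<^sup>2\<close> part of \<open>n\<^sub>t\<close> is the velocity of the linear wave driven by \<open>\<Delta>\<bar>v\<bar>\<^sup>2\<close>, where \<open>v\<close> is the free
Schroedinger evolution of \<open>u0\<close>. Up to a time \<open>t\<close> of order \<open>N\<^sup>-\<^sup>2\<close> no phase has turned
by more than 1, so there is no cancellation and the coefficients of this velocity at
frequencies of size \<open>N\<close> are of size \<open>t N\<^sup>2 N\<^sup>d = N\<^sup>d\<close>. Boundedness of the second derivative
\<open>H\<^sup>s \<times> H\<^sup>s \<rightarrow> H\<^bsup>s-3/2\<^esup>\<close> would then force \<open>N\<^bsup>d + s - 3/2 + d/2\<^esup> \<lesssim> N\<^bsup>2s + d\<^esup>\<close>,
that is \<open>s \<ge> (d - 3)/2\<close>.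

To compute the second derivative one needs solutions on all of \<open>[0,T]\<close>. For trigonometric
polynomials and small \<open>\<epsilon>\<close> they come from a contraction in the norm
\<open>\<Sum>\<^sub>k sup\<^sub>t exp((1 + T - t)\<bar>k\<bar>) \<bar>f(t,k)\<bar>\<close>: the shrinking radius of analyticity pays for the
derivative lost in the wave equation, as \<open>\<bar>k\<bar> \<integral>\<^sub>0\<^sup>t exp(-(t - s)\<bar>k\<bar>) ds \<le> 1\<close>.\<close>

section \<open>Weighted Wiener norms\<close>

text \<open>Euclidean length of the lattice vector: the frequency of the half waves, just as
  \<open>ksq\<close> is that of the Schroedinger evolution.\<close>

definition freq :: "int ^ ('d::finite) \<Rightarrow> real" where
  "freq k = sqrt (ksq k)"

lemma ksq_nonneg: "0 \<le> ksq k"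
  by (simp add: ksq_def sum_nonneg)

lemma freq_nonneg: "0 \<le> freq k"
  by (simp add: freq_def ksq_nonneg)

lemma freq_squared: "(freq k)\<^sup>2 = ksq k"
  by (simp add: freq_def ksq_nonneg)

lemma ksq_uminus [simp]: "ksq (- k) = ksq k"
  by (simp add: ksq_def)

lemma freq_uminus [simp]: "freq (- k) = freq k"
  by (simp add: freq_def)

lemma freq_eq_norm: "freq k = norm (\<chi> i. real_of_int (k $ i))"
  by (simp add: freq_def ksq_def norm_vec_def L2_set_def)

lemma freq_triangle: "freq k \<le> freq j + freq (k - j)"
proof -
  have "(\<chi> i. real_of_int (k $ i)) = (\<chi> i. real_of_int (j $ i)) + (\<chi> i. real_of_int ((k - j) $ i))"
    by (simp add: vec_eq_iff)
  then show ?thesis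
    unfolding freq_eq_norm by (metis norm_triangle_ineq)
qed

text \<open>The radius of analyticity \<open>1 + T - t\<close> falls from \<open>1 + T\<close> to 1,
  so a factor \<open>exp (freq k)\<close> survives even at the final time; it later beats every
  polynomial weight.\<close>

definition weight :: "real \<Rightarrow> real \<Rightarrow> int ^ ('d::finite) \<Rightarrow> real" where
  "weight T t k = exp ((1 + T - t) * freq k)"

lemma weight_ge_1: "t \<le> T \<Longrightarrow> 1 \<le> weight T t k"
  by (simp add: weight_def freq_nonneg)

lemma weight_pos: "0 < weight T t k"
  by (simp add: weight_def)

lemma weight_uminus [simp]: "weight T t (- k) = weight T t k"
  by (simp add: weight_def)

lemma weight_submult:
  assumes "t \<le> T"
  shows "weight T t k \<le> weight T t j * weight T t (k - j)"
proof -
  have "(1 + T - t) * freq k \<le> (1 + T - t) * (freq j + freq (k - j))"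
    using assms by (intro mult_left_mono freq_triangle) auto
  then show ?thesis
    by (simp add: weight_def distrib_left flip: exp_add)
qed

text \<open>An upper bound \<open>r\<close> for the sum over \<open>k\<close> of suprema over
  \<open>t\<close>, expressed by a majorant \<open>a\<close> independent of \<open>t\<close>;
  finiteness and existence of suprema then need no separate care. Continuity of the coefficients
  makes time integrals meaningful.\<close>

definition wbd :: "real \<Rightarrow> real \<Rightarrow> (real \<Rightarrow> ('d::finite) fc) \<Rightarrow> bool" where
  "wbd T r f \<longleftrightarrow> (\<forall>k. continuous_on {0..T} (\<lambda>t. f t k)) \<and>
     (\<exists>a. a summable_on UNIV \<and> infsum a UNIV \<le> r \<and>
          (\<forall>k. 0 \<le> a k) \<and> (\<forall>t\<in>{0..T}. \<forall>k. cmod (f t k) * weight T t k \<le> a k))"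

lemma wbdI:
  assumes "\<And>k. continuous_on {0..T} (\<lambda>t. f t k)"
    and "a summable_on UNIV" and "infsum a UNIV \<le> r" and "\<And>k. 0 \<le> a k"
    and "\<And>t k. 0 \<le> t \<Longrightarrow> t \<le> T \<Longrightarrow> cmod (f t k) * weight T t k \<le> a k"
  shows "wbd T r f"
  unfolding wbd_def using assms by (auto intro!: exI[of _ a])

text \<open>The unweighted bounds come from \<open>weight\<close> being at least 1 on
  \<open>{0..T}\<close>, and \<open>a k \<le> r\<close> from one nonnegative term being below the
  whole sum.\<close>

lemma wbdE:
  assumes "wbd T r f"
  obtains a where "a summable_on UNIV" and "infsum a UNIV \<le> r" and "\<And>k. 0 \<le> a k"
    and "\<And>t k. 0 \<le> t \<Longrightarrow> t \<le> T \<Longrightarrow> cmod (f t k) * weight T t k \<le> a k"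
    and "\<And>t k. 0 \<le> t \<Longrightarrow> t \<le> T \<Longrightarrow> cmod (f t k) \<le> a k"
    and "\<And>k. a k \<le> r" and "0 \<le> r"
proof -
  obtain a where a: "a summable_on UNIV" "infsum a UNIV \<le> r" "\<And>k. 0 \<le> a k"
    and le: "\<And>t k. 0 \<le> t \<Longrightarrow> t \<le> T \<Longrightarrow> cmod (f t k) * weight T t k \<le> a k"
    using assms unfolding wbd_def by auto
  have 1: "cmod (f t k) \<le> a k" if "0 \<le> t" "t \<le> T" for t k
  proof -
    have "cmod (f t k) * 1 \<le> cmod (f t k) * weight T t k"
      using that by (intro mult_left_mono weight_ge_1) auto
    then show ?thesis using le[OF that, of k] by simp
  qed
  have 2: "a k \<le> r" for k
    using finite_sum_le_infsum[of a UNIV "{k}"] a by simp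
  have 3: "0 \<le> r"
    using 2[of 0] a(3)[of 0] by linarith
  show ?thesis
    by (rule that[OF a le 1 2 3])
qed

lemma wbd_continuous: "wbd T r f \<Longrightarrow> continuous_on {0..T} (\<lambda>t. f t k)"
  by (simp add: wbd_def)

lemma wbd_mono: "wbd T r f \<Longrightarrow> r \<le> q \<Longrightarrow> wbd T q f"
  unfolding wbd_def by (meson order_trans)

lemma wbd_norm_le: "wbd T r f \<Longrightarrow> 0 \<le> t \<Longrightarrow> t \<le> T \<Longrightarrow> cmod (f t k) \<le> r"
  by (erule wbdE) (meson order_trans)

lemma wbd_cong:
  assumes "wbd T r f" and eq: "\<And>t k. 0 \<le> t \<Longrightarrow> t \<le> T \<Longrightarrow> g t k = f t k"
  shows "wbd T r g"
proof -
  obtain a where a: "a summable_on UNIV" "infsum a UNIV \<le> r" "\<And>k. 0 \<le> a k"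
    "\<And>t k. 0 \<le> t \<Longrightarrow> t \<le> T \<Longrightarrow> cmod (f t k) * weight T t k \<le> a k"
    using assms(1) by (elim wbdE) blast
  have "continuous_on {0..T} (\<lambda>t. g t k) = continuous_on {0..T} (\<lambda>t. f t k)" for k
    using eq by (intro continuous_on_cong) auto
  then show ?thesis
    using a eq wbd_continuous[OF assms(1)] by (intro wbdI[where a = a]) auto
qed

lemma wbd_zero: "0 \<le> r \<Longrightarrow> wbd T r (\<lambda>t k. 0)"
  by (rule wbdI[where a = "\<lambda>k. 0"]) auto

lemma wbd_add:
  assumes "wbd T r f" and "wbd T q g"
  shows "wbd T (r + q) (\<lambda>t k. f t k + g t k)"
proof -
  obtain a where a: "a summable_on UNIV" "infsum a UNIV \<le> r" "\<And>k. 0 \<le> a k"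
    "\<And>t k. 0 \<le> t \<Longrightarrow> t \<le> T \<Longrightarrow> cmod (f t k) * weight T t k \<le> a k"
    using assms(1) by (elim wbdE) blast
  obtain b where b: "b summable_on UNIV" "infsum b UNIV \<le> q" "\<And>k. 0 \<le> b k"
    "\<And>t k. 0 \<le> t \<Longrightarrow> t \<le> T \<Longrightarrow> cmod (g t k) * weight T t k \<le> b k"
    using assms(2) by (elim wbdE) blast
  show ?thesis
  proof (rule wbdI[where a = "\<lambda>k. a k + b k"])
    show "continuous_on {0..T} (\<lambda>t. f t k + g t k)" for k
      using assms by (intro continuous_intros wbd_continuous)
    show "(\<lambda>k. a k + b k) summable_on UNIV"
      using a b by (intro summable_on_add)
    show "(\<Sum>\<^sub>\<infinity>k. a k + b k) \<le> r + q"
      using a b by (simp add: infsum_add)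
    show "0 \<le> a k + b k" for k using a b by simp
    fix t k assume t: "0 \<le> t" "t \<le> T"
    have "cmod (f t k + g t k) * weight T t k \<le> (cmod (f t k) + cmod (g t k)) * weight T t k"
      by (intro mult_right_mono norm_triangle_ineq less_imp_le weight_pos)
    then show "cmod (f t k + g t k) * weight T t k \<le> a k + b k"
      using a(4)[OF t, of k] b(4)[OF t, of k] by (simp add: distrib_right)
  qed
qed

text \<open>Transfer principle for operators acting frequency by frequency. The hypothesis
  \<open>bound\<close> is quantified over the number \<open>a\<close> so that each value of the
  majorant of \<open>f\<close> can be inserted.\<close>

lemma wbd_dominated:
  assumes "wbd T r f" and "0 \<le> c"
    and cont: "\<And>k. continuous_on {0..T} (\<lambda>t. g t k)"
    and bound: "\<And>a t k. (\<And>s. 0 \<le> s \<Longrightarrow> s \<le> T \<Longrightarrow> cmod (f s k) * weight T s k \<le> a) \<Longrightarrow> 0 \<le> a \<Longrightarrow>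
       0 \<le> t \<Longrightarrow> t \<le> T \<Longrightarrow> cmod (g t k) * weight T t k \<le> c * a"
  shows "wbd T (c * r) g"
proof -
  obtain a where a: "a summable_on UNIV" "infsum a UNIV \<le> r" "\<And>k. 0 \<le> a k"
    "\<And>t k. 0 \<le> t \<Longrightarrow> t \<le> T \<Longrightarrow> cmod (f t k) * weight T t k \<le> a k"
    using assms(1) by (elim wbdE) blast
  show ?thesis
    by (rule wbdI[where a = "\<lambda>k. c * a k"])
       (use a \<open>0 \<le> c\<close> in \<open>auto intro!: cont bound summable_on_cmult_right mult_left_mono simp: infsum_cmult_right'\<close>)
qed

lemma wbd_cmult:
  assumes "wbd T r f" shows "wbd T (cmod c * r) (\<lambda>t k. c * f t k)"
  by (rule wbd_dominated[OF assms])
     (auto intro!: continuous_intros wbd_continuous[OF assms] mult_left_mono simp: norm_mult mult.assoc)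

lemma wbd_uminus: "wbd T r f \<Longrightarrow> wbd T r (\<lambda>t k. - f t k)"
  using wbd_cmult[of T r f "- 1"] by simp

lemma wbd_diff:
  "wbd T r f \<Longrightarrow> wbd T q g \<Longrightarrow> wbd T (r + q) (\<lambda>t k. f t k - g t k)"
  using wbd_add[OF _ wbd_uminus, of T r f q g] by simp

section \<open>Complex conjugation (\<open>flip\<close>) and products (\<open>conv\<close>) of
  functions, read on Fourier coefficients\<close>

definition flip :: "(real \<Rightarrow> ('d::finite) fc) \<Rightarrow> real \<Rightarrow> 'd fc" where
  "flip f t k = cnj (f t (- k))"

lemma wbd_flip:
  assumes "wbd T r f" shows "wbd T r (flip f)"
proof -
  obtain a where a: "a summable_on UNIV" "infsum a UNIV \<le> r" "\<And>k. 0 \<le> a k"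
    "\<And>t k. 0 \<le> t \<Longrightarrow> t \<le> T \<Longrightarrow> cmod (f t k) * weight T t k \<le> a k"
    using assms(1) by (elim wbdE) blast
  have s: "(\<lambda>k. a (- k)) summable_on UNIV \<longleftrightarrow> a summable_on UNIV"
    by (rule summable_on_reindex_bij_witness[where i = uminus and j = uminus]) auto
  have i: "(\<Sum>\<^sub>\<infinity>k. a (- k)) = infsum a UNIV"
    by (rule infsum_reindex_bij_witness[where i = uminus and j = uminus]) auto
  show ?thesis
  proof (rule wbdI[where a = "\<lambda>k. a (- k)"])
    show "cmod (flip f t k) * weight T t k \<le> a (- k)" if "0 \<le> t" "t \<le> T" for t k
      using a(4)[OF that, of "- k"] by (simp add: flip_def)
  qed (use a s i in \<open>auto simp: flip_def intro!: continuous_intros wbd_continuous[OF assms]\<close>)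
qed

definition conv :: "(real \<Rightarrow> ('d::finite) fc) \<Rightarrow> (real \<Rightarrow> 'd fc) \<Rightarrow> real \<Rightarrow> 'd fc" where
  "conv f g t k = (\<Sum>\<^sub>\<infinity>j. f t j * g t (k - j))"

text \<open>Tonelli on the pairs \<open>(j, k)\<close>: for fixed \<open>j\<close> the sum over
  \<open>k\<close> runs over a translate of \<open>b\<close>, so the double sum factors; exchanging
  the two variables then gives the convolution.\<close>

lemma summable_on_convolution:
  fixes a b :: "int ^ ('d::finite) \<Rightarrow> real"
  assumes "a summable_on UNIV" and "b summable_on UNIV"
    and "\<And>k. 0 \<le> a k" and "\<And>k. 0 \<le> b k"
  shows "(\<lambda>j. a j * b (k - j)) summable_on UNIV"
    and "(\<lambda>k. \<Sum>\<^sub>\<infinity>j. a j * b (k - j)) summable_on UNIV"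
    and "(\<Sum>\<^sub>\<infinity>k. \<Sum>\<^sub>\<infinity>j. a j * b (k - j)) = infsum a UNIV * infsum b UNIV"
proof -
  have shift: "((\<lambda>k. b (k - j)) has_sum infsum b UNIV) UNIV" for j
    using has_sum_infsum[OF assms(2)]
    by (subst has_sum_reindex_bij_witness[where i = "\<lambda>k. k + j" and j = "\<lambda>k. k - j" and h = b and T = UNIV]) auto
  have "((\<lambda>(j, k). a j * b (k - j)) has_sum infsum a UNIV * infsum b UNIV) (UNIV \<times> UNIV)"
  proof (rule has_sum_SigmaI)
    show "((\<lambda>k. (case (j, k) of (j, k) \<Rightarrow> a j * b (k - j))) has_sum a j * infsum b UNIV) UNIV" for j
      using has_sum_cmult_right[OF shift] by simp
    show "((\<lambda>j. a j * infsum b UNIV) has_sum infsum a UNIV * infsum b UNIV) UNIV"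
      using assms(1) by (intro has_sum_cmult_left has_sum_infsum)
    show "(\<lambda>(j, k). a j * b (k - j)) summable_on UNIV \<times> UNIV"
    proof (rule summable_on_SigmaI)
      show "((\<lambda>k. (case (j, k) of (j, k) \<Rightarrow> a j * b (k - j))) has_sum a j * infsum b UNIV) UNIV" for j
        using has_sum_cmult_right[OF shift] by simp
      show "(\<lambda>j. a j * infsum b UNIV) summable_on UNIV"
        using assms(1) by (rule summable_on_cmult_left)
    qed (use assms in auto)
  qed
  then have P: "((\<lambda>(k, j). a j * b (k - j)) has_sum infsum a UNIV * infsum b UNIV) (UNIV \<times> UNIV)"
    by (subst (asm) has_sum_swap) simp
  then have ps: "(\<lambda>(k, j). a j * b (k - j)) summable_on UNIV \<times> UNIV"
    by (rule has_sum_imp_summable)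
  show 1: "(\<lambda>j. a j * b (k - j)) summable_on UNIV" for k
    using summable_on_SigmaD1[OF ps, of k] by simp
  have "((\<lambda>k. \<Sum>\<^sub>\<infinity>j. a j * b (k - j)) has_sum infsum a UNIV * infsum b UNIV) UNIV"
    by (rule has_sum_SigmaD[OF P]) (use 1 in auto)
  then show "(\<lambda>k. \<Sum>\<^sub>\<infinity>j. a j * b (k - j)) summable_on UNIV"
    "(\<Sum>\<^sub>\<infinity>k. \<Sum>\<^sub>\<infinity>j. a j * b (k - j)) = infsum a UNIV * infsum b UNIV"
    by (auto simp: has_sum_iff)
qed

lemma conv_summable:
  assumes "wbd T r f" and "wbd T q g" and "0 \<le> t" "t \<le> T"
  shows "(\<lambda>j. f t j * g t (k - j)) summable_on UNIV"
proof -
  obtain a where a: "a summable_on UNIV" "\<And>k. 0 \<le> a k"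
    "\<And>t k. 0 \<le> t \<Longrightarrow> t \<le> T \<Longrightarrow> cmod (f t k) \<le> a k"
    using assms(1) by (elim wbdE) blast
  obtain b where b: "b summable_on UNIV" "\<And>k. 0 \<le> b k"
    "\<And>t k. 0 \<le> t \<Longrightarrow> t \<le> T \<Longrightarrow> cmod (g t k) \<le> b k"
    using assms(2) by (elim wbdE) blast
  have "(\<lambda>j. norm (f t j * g t (k - j))) summable_on UNIV"
    by (rule Infinite_Sum.abs_summable_on_comparison_test'[OF summable_on_convolution(1)[OF a(1) b(1) a(2) b(2)]])
       (use a b assms(3,4) in \<open>auto simp: norm_mult intro!: mult_mono\<close>)
  then show ?thesis by (rule abs_summable_summable)
qed

text \<open>Algebra property of the norm: by submultiplicativity of the weight, the convolution of
  the two majorants is a majorant of the product.\<close>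

lemma wbd_conv:
  assumes "wbd T r f" and "wbd T q g"
  shows "wbd T (r * q) (conv f g)"
proof -
  obtain a where a: "a summable_on UNIV" "infsum a UNIV \<le> r" "\<And>k. 0 \<le> a k"
    "\<And>t k. 0 \<le> t \<Longrightarrow> t \<le> T \<Longrightarrow> cmod (f t k) * weight T t k \<le> a k"
    "\<And>t k. 0 \<le> t \<Longrightarrow> t \<le> T \<Longrightarrow> cmod (f t k) \<le> a k" "0 \<le> r"
    using assms(1) by (elim wbdE) blast
  obtain b where b: "b summable_on UNIV" "infsum b UNIV \<le> q" "\<And>k. 0 \<le> b k"
    "\<And>t k. 0 \<le> t \<Longrightarrow> t \<le> T \<Longrightarrow> cmod (g t k) * weight T t k \<le> b k"
    "\<And>t k. 0 \<le> t \<Longrightarrow> t \<le> T \<Longrightarrow> cmod (g t k) \<le> b k"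
    using assms(2) by (elim wbdE) blast
  note ab = summable_on_convolution[OF a(1) b(1) a(3) b(3)]
  show ?thesis
  proof (rule wbdI[where a = "\<lambda>k. \<Sum>\<^sub>\<infinity>j. a j * b (k - j)"])
    show "continuous_on {0..T} (\<lambda>t. conv f g t k)" for k
    proof -
      \<comment> \<open>The dominating terms do not involve \<open>t\<close>, so the series
        converges uniformly in time and its sum inherits continuity.\<close>
      have "uniform_limit {0..T} (\<lambda>X t. \<Sum>j\<in>X. f t j * g t (k - j)) (\<lambda>t. \<Sum>\<^sub>\<infinity>j\<in>UNIV. f t j * g t (k - j))
              (finite_subsets_at_top UNIV)"
        by (rule Weierstrass_m_test_general[where M = "\<lambda>j. a j * b (k - j)"])
           (use a b ab(1) in \<open>auto simp: norm_mult intro!: mult_mono\<close>)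
      then show ?thesis
        unfolding conv_def
        by (rule uniform_limit_theorem[rotated])
           (simp, intro always_eventually allI continuous_intros wbd_continuous[OF assms(1)]
              wbd_continuous[OF assms(2)])
    qed
    show "(\<Sum>\<^sub>\<infinity>k. \<Sum>\<^sub>\<infinity>j. a j * b (k - j)) \<le> r * q"
      unfolding ab(3) using a b by (intro mult_mono infsum_nonneg) auto
    show "0 \<le> (\<Sum>\<^sub>\<infinity>j. a j * b (k - j))" for k
      using a b by (intro infsum_nonneg) auto
    fix t k assume t: "0 \<le> t" "t \<le> T"
    have "cmod (conv f g t k * weight T t k) \<le> (\<Sum>\<^sub>\<infinity>j. a j * b (k - j))"
      unfolding conv_def
    proof (rule norm_infsum_le)
      show "((\<lambda>j. f t j * g t (k - j) * weight T t k) has_sum (\<Sum>\<^sub>\<infinity>j. f t j * g t (k - j)) * weight T t k) UNIV"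
        by (intro has_sum_cmult_left has_sum_infsum conv_summable[OF assms t])
      show "((\<lambda>j. a j * b (k - j)) has_sum (\<Sum>\<^sub>\<infinity>j. a j * b (k - j))) UNIV"
        by (intro has_sum_infsum ab)
      fix j
      have "cmod (f t j * g t (k - j) * weight T t k)
          \<le> cmod (f t j) * cmod (g t (k - j)) * (weight T t j * weight T t (k - j))"
        using weight_submult[OF t(2), of k j] weight_pos[of T t k]
        by (simp add: norm_mult mult_left_mono)
      also have "\<dots> = (cmod (f t j) * weight T t j) * (cmod (g t (k - j)) * weight T t (k - j))"
        by simp
      also have "\<dots> \<le> a j * b (k - j)"
        using a(4)[OF t] b(4)[OF t] a(3) weight_pos[of T t "k - j"] by (intro mult_mono) auto
      finally show "cmod (f t j * g t (k - j) * weight T t k) \<le> a j * b (k - j)" .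
    qed
    then show "cmod (conv f g t k) * weight T t k \<le> (\<Sum>\<^sub>\<infinity>j. a j * b (k - j))"
      using weight_pos[of T t k] by (simp add: norm_mult)
  qed (use ab in auto)
qed

text \<open>Bilinearity: \<open>f g - f' g' = (f - f') g + f' (g - g')\<close>, where the
  summability of every product allows the series to be split.\<close>

lemma conv_diff:
  fixes f f' g g' :: "real \<Rightarrow> ('d::finite) fc"
  assumes "wbd T r f" and "wbd T r f'" and "wbd T q g" and "wbd T q g'"
    and "wbd T d (\<lambda>t k. f t k - f' t k)" and "wbd T e (\<lambda>t k. g t k - g' t k)"
  shows "wbd T (d * q + r * e) (\<lambda>t k. conv f g t k - conv f' g' t k)"
proof (rule wbd_cong[OF wbd_add[OF wbd_conv[OF assms(5,3)] wbd_conv[OF assms(2,6)]]])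
  fix t k assume t: "0 \<le> t" "t \<le> T"
  have s: "((\<lambda>j. f t j * g t (k - j)) has_sum conv f g t k) UNIV"
    if "wbd T r f" "wbd T q g" for r q and f g :: "real \<Rightarrow> 'd fc"
    unfolding conv_def by (intro has_sum_infsum conv_summable[OF that t])
  have "((\<lambda>j. f t j * g t (k - j) + - (f' t j * g' t (k - j))) has_sum conv f g t k + - conv f' g' t k) UNIV"
    by (intro has_sum_add has_sum_uminusI s[OF assms(1,3)] s[OF assms(2,4)])
  moreover have "((\<lambda>j. f t j * g t (k - j) + - (f' t j * g' t (k - j))) has_sum
     conv (\<lambda>t k. f t k - f' t k) g t k + conv f' (\<lambda>t k. g t k - g' t k) t k) UNIV"
    using has_sum_add[OF s[OF assms(5,3)] s[OF assms(2,6)]] by (simp add: algebra_simps)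
  ultimately show "conv f g t k - conv f' g' t k =
     conv (\<lambda>t k. f t k - f' t k) g t k + conv f' (\<lambda>t k. g t k - g' t k) t k"
    using has_sum_unique by fastforce
qed

section \<open>Duhamel operators\<close>

definition coeffs_continuous :: "real \<Rightarrow> (real \<Rightarrow> ('d::finite) fc) \<Rightarrow> bool" where
  "coeffs_continuous T f \<longleftrightarrow> (\<forall>k. continuous_on {0..T} (\<lambda>t. f t k))"

lemma coeffs_continuousD: "coeffs_continuous T f \<Longrightarrow> continuous_on {0..T} (\<lambda>t. f t k)"
  by (simp add: coeffs_continuous_def)

lemma wbd_coeffs_continuous: "wbd T r f \<Longrightarrow> coeffs_continuous T f"
  by (simp add: coeffs_continuous_def wbd_continuous)

text \<open>Duhamel integral for \<open>y' = - i L y + f\<close> with zero initial value, the outer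
  phase being pulled out of the integral.\<close>

definition duh :: "(int ^ ('d::finite) \<Rightarrow> real) \<Rightarrow> (real \<Rightarrow> 'd fc) \<Rightarrow> real \<Rightarrow> 'd fc" where
  "duh L f t k = cis (- L k * t) * integral {0..t} (\<lambda>s. cis (L k * s) * f s k)"

lemma cis_has_vector_derivative:
  "((\<lambda>t. cis (c * t)) has_vector_derivative \<i> * of_real c * cis (c * t)) (at t within S)"
proof -
  have "((\<lambda>t. exp (of_real t * (\<i> * of_real c))) has_vector_derivative
      \<i> * of_real c * exp (of_real t * (\<i> * of_real c))) (at t within S)"
    by (rule has_vector_derivative_eq_rhs[OF has_vector_derivative_real_field[where 'a = complex]])
       (auto intro!: derivative_eq_intros)
  then show ?thesis
    by (simp add: cis_conv_exp mult_ac)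
qed

lemma duh_integrand_continuous:
  assumes "coeffs_continuous T f" and "t \<le> T"
  shows "continuous_on {0..t} (\<lambda>s. cis (L k * s) * f s k)"
  by (intro continuous_intros continuous_on_subset[OF coeffs_continuousD[OF assms(1)]])
     (use assms(2) in auto)

lemma duh_has_vector_derivative:
  assumes "coeffs_continuous T f" and "t \<in> {0..T}"
  shows "((\<lambda>t. duh L f t k) has_vector_derivative (- \<i> * of_real (L k) * duh L f t k + f t k))
           (at t within {0..T})"
proof -
  have "((\<lambda>t. integral {0..t} (\<lambda>s. cis (L k * s) * f s k)) has_vector_derivative cis (L k * t) * f t k)
     (at t within {0..T})"
    by (rule integral_has_vector_derivative[OF duh_integrand_continuous[OF assms(1)]]) (use assms(2) in auto)
  from has_vector_derivative_mult[OF cis_has_vector_derivative[of "- L k" t "{0..T}"] this]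
  show ?thesis
    unfolding duh_def
    by (rule has_vector_derivative_eq_rhs) (simp add: cis_mult flip: mult.assoc)
qed

lemma duh_continuous:
  assumes "coeffs_continuous T f"
  shows "continuous_on {0..T} (\<lambda>t. duh L f t k)"
  by (rule continuous_on_vector_derivative) (rule duh_has_vector_derivative[OF assms])

lemma duh_0 [simp]: "duh L f 0 k = 0"
  by (simp add: duh_def)

lemma duh_diff:
  assumes "coeffs_continuous T f" and "coeffs_continuous T g" and "t \<le> T"
  shows "duh L (\<lambda>s k. f s k - g s k) t k = duh L f t k - duh L g t k"
  unfolding duh_def
  using integral_diff[OF
      integrable_continuous_interval[OF duh_integrand_continuous[where L = L and k = k, OF assms(1,3)]]
      integrable_continuous_interval[OF duh_integrand_continuous[where L = L and k = k, OF assms(2,3)]]]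
  by (simp add: right_diff_distrib)

lemma duh_cmult: "duh L (\<lambda>s k. c * f s k) t k = c * duh L f t k"
  unfolding duh_def by (simp add: mult.left_commute)

lemma cnj_duh: "cnj (duh L f t k) = duh (\<lambda>k. - L k) (\<lambda>s k. cnj (f s k)) t k"
  unfolding duh_def by (simp add: cis_cnj integral_cnj)

lemma duh_cong:
  assumes "\<And>s. 0 \<le> s \<Longrightarrow> s \<le> t \<Longrightarrow> f s k = g s k'" and "L k = L' k'"
  shows "duh L f t k = duh L' g t k'"
  unfolding duh_def using assms by (auto intro!: arg_cong2[of _ _ _ _ "(*)"] integral_cong)

text \<open>The first estimate only uses that the weight decreases in time. The second gains one
  derivative: integrating the growing exponential \<open>exp (- (1 + T - s) * freq k)\<close> in
  \<open>s\<close> produces a factor \<open>1 / freq k\<close>.\<close>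

lemma duh_bound:
  assumes cont: "coeffs_continuous T f" and "0 \<le> t" "t \<le> T"
    and le: "\<And>s. 0 \<le> s \<Longrightarrow> s \<le> T \<Longrightarrow> cmod (f s k) * weight T s k \<le> a" and "0 \<le> a"
  shows "cmod (duh L f t k) * weight T t k \<le> T * a"
    and "freq k * cmod (duh L f t k) * weight T t k \<le> a"
proof -
  let ?g = "\<lambda>s. cis (L k * s) * f s k"
  note cg = duh_integrand_continuous[where L = L, OF cont \<open>t \<le> T\<close>]
  have eq: "cmod (duh L f t k) = cmod (integral {0..t} ?g)"
    by (simp add: duh_def norm_mult)
  have g: "cmod (?g s) \<le> a / weight T s k" if "s \<in> {0..t}" for s
    using le[of s] that assms(3) weight_pos[of T s k] by (simp add: norm_mult pos_le_divide_eq)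
  have "a / weight T s k \<le> a / weight T t k" if "s \<in> {0..t}" for s
  proof -
    have "weight T t k \<le> weight T s k"
      using that freq_nonneg[of k] by (auto simp: weight_def mult_right_mono)
    then show ?thesis
      using \<open>0 \<le> a\<close> weight_pos[of T t k] weight_pos[of T s k] by (intro divide_left_mono) auto
  qed
  then have "cmod (integral {0..t} ?g) \<le> a / weight T t k * (t - 0)"
    using g by (intro integral_bound[OF assms(2) cg]) fastforce
  also have "\<dots> \<le> a / weight T t k * T"
    using assms weight_pos[of T t k] by (intro mult_left_mono) auto
  finally show "cmod (duh L f t k) * weight T t k \<le> T * a"
    using weight_pos[of T t k] by (simp add: eq field_simps)
  \<comment> \<open>\<open>h\<close> is an antiderivative of \<open>freq k * h\<close>, so the
    integral is evaluated without dividing by \<open>freq k\<close>, and \<open>k = 0\<close> needs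
    no separate case.\<close>
  define h where "h s = a * exp (- ((1 + T - s) * freq k))" for s
  have "((\<lambda>s. freq k * h s) has_integral (h t - h 0)) {0..t}"
    unfolding h_def
    by (rule fundamental_theorem_of_calculus[OF assms(2)])
       (auto intro!: derivative_eq_intros simp flip: has_real_derivative_iff_has_vector_derivative)
  moreover have "freq k * (a / weight T s k) = freq k * h s" for s
    by (simp add: h_def weight_def exp_minus divide_inverse)
  ultimately have hi: "((\<lambda>s. freq k * (a / weight T s k)) has_integral (h t - h 0)) {0..t}"
    by simp
  have "freq k * cmod (integral {0..t} ?g) = cmod (integral {0..t} (\<lambda>s. freq k * ?g s))"
    by (simp add: norm_mult freq_nonneg)
  also have "\<dots> \<le> integral {0..t} (\<lambda>s. freq k * (a / weight T s k))"
  proof (rule integral_norm_bound_integral)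
    show "(\<lambda>s. complex_of_real (freq k) * ?g s) integrable_on {0..t}"
      by (intro integrable_continuous_interval continuous_on_mult_left cg)
    show "(\<lambda>s. freq k * (a / weight T s k)) integrable_on {0..t}"
      using hi by blast
    show "cmod (complex_of_real (freq k) * ?g s) \<le> freq k * (a / weight T s k)" if "s \<in> {0..t}" for s
      using mult_left_mono[OF g[OF that] freq_nonneg[of k]] by (simp add: norm_mult freq_nonneg)
  qed
  also have "\<dots> = h t - h 0"
    using hi by (rule integral_unique)
  also have "\<dots> \<le> h t"
    using \<open>0 \<le> a\<close> by (simp add: h_def)
  also have "h t = a / weight T t k"
    by (simp add: h_def weight_def exp_minus divide_inverse)
  finally show "freq k * cmod (duh L f t k) * weight T t k \<le> a"
    using weight_pos[of T t k] by (simp add: eq pos_le_divide_eq)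
qed

lemma wbd_duh:
  assumes "wbd T r f" and "0 \<le> T"
  shows "wbd T (T * r) (duh L f)"
  by (rule wbd_dominated[OF assms])
     (auto intro!: duh_continuous duh_bound(1) wbd_coeffs_continuous[OF assms(1)])

lemma wbd_freq_duh:
  assumes "wbd T r f"
  shows "wbd T r (\<lambda>t k. of_real (freq k) * duh L f t k)"
proof -
  have "wbd T (1 * r) (\<lambda>t k. of_real (freq k) * duh L f t k)"
  proof (rule wbd_dominated[OF assms])
    show "continuous_on {0..T} (\<lambda>t. of_real (freq k) * duh L f t k)" for k
      by (intro continuous_on_mult_left duh_continuous wbd_coeffs_continuous[OF assms])
    fix a t k assume "\<And>s. 0 \<le> s \<Longrightarrow> s \<le> T \<Longrightarrow> cmod (f s k) * weight T s k \<le> a" "0 \<le> a" "0 \<le> t" "t \<le> T"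
    then show "cmod (of_real (freq k) * duh L f t k) * weight T t k \<le> 1 * a"
      using duh_bound(2)[OF wbd_coeffs_continuous[OF assms]] by (simp add: norm_mult freq_nonneg)
  qed simp
  then show ?thesis by simp
qed

text \<open>The solution of \<open>n'' + \<bar>k\<bar>\<^sup>2 n = - \<bar>k\<bar>\<^sup>2 f\<close> with zero data, with the sine kernel split into the two
half waves \<open>e\<^bsup>\<plusminus>i\<bar>k\<bar>t\<^esup>\<close> so that the estimates for \<open>duh\<close> apply.\<close>
definition wave :: "(real \<Rightarrow> ('d::finite) fc) \<Rightarrow> real \<Rightarrow> 'd fc" where
  "wave f t k = \<i> / 2 * (of_real (freq k) * duh (\<lambda>k. - freq k) f t k - of_real (freq k) * duh freq f t k)"

definition wave_deriv :: "(real \<Rightarrow> ('d::finite) fc) \<Rightarrow> real \<Rightarrow> 'd fc" where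
  "wave_deriv f t k = - of_real (ksq k) / 2 * (duh (\<lambda>k. - freq k) f t k + duh freq f t k)"

lemma of_real_freq_squared: "complex_of_real (freq k) * complex_of_real (freq k) = complex_of_real (ksq k)"
  using freq_squared[of k] by (simp add: power2_eq_square flip: of_real_mult)

text \<open>Each half wave contributes a source term \<open>f\<close>; the two cancel in the
  difference.\<close>

lemma wave_has_vector_derivative:
  assumes "coeffs_continuous T f" and "t \<in> {0..T}"
  shows "((\<lambda>t. wave f t k) has_vector_derivative wave_deriv f t k) (at t within {0..T})"
proof -
  have "((\<lambda>t. wave f t k) has_vector_derivative
     \<i> / 2 * (of_real (freq k) * (- \<i> * of_real (- freq k) * duh (\<lambda>k. - freq k) f t k + f t k)
       - of_real (freq k) * (- \<i> * of_real (freq k) * duh freq f t k + f t k))) (at t within {0..T})"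
    unfolding wave_def
    by (intro has_vector_derivative_mult_right has_vector_derivative_diff duh_has_vector_derivative assms)
  then show ?thesis
    by (rule has_vector_derivative_eq_rhs)
       (simp add: wave_deriv_def algebra_simps flip: of_real_freq_squared)
qed

text \<open>Here the half waves are added, so their source terms add up to the forcing
  \<open>- ksq k * f\<close>.\<close>

lemma wave_deriv_has_vector_derivative:
  assumes "coeffs_continuous T f" and "t \<in> {0..T}"
  shows "((\<lambda>t. wave_deriv f t k) has_vector_derivative
           (- of_real (ksq k) * wave f t k - of_real (ksq k) * f t k)) (at t within {0..T})"
proof -
  have "((\<lambda>t. wave_deriv f t k) has_vector_derivative
     - of_real (ksq k) / 2 * ((- \<i> * of_real (- freq k) * duh (\<lambda>k. - freq k) f t k + f t k)
       + (- \<i> * of_real (freq k) * duh freq f t k + f t k))) (at t within {0..T})"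
    unfolding wave_deriv_def
    by (intro has_vector_derivative_mult_right has_vector_derivative_add duh_has_vector_derivative assms)
  then show ?thesis
    by (rule has_vector_derivative_eq_rhs) (simp add: wave_def field_simps)
qed

text \<open>The two half waves cost \<open>r\<close> each and the prefactor has modulus 1/2, so the
  solution operator has norm at most 1, whatever \<open>T\<close> is.\<close>

lemma wbd_wave:
  assumes "wbd T r f" shows "wbd T r (wave f)"
  using wbd_cmult[OF wbd_diff[OF wbd_freq_duh[OF assms] wbd_freq_duh[OF assms]], of "\<i> / 2"]
  by (simp add: wave_def[abs_def] norm_divide norm_mult)

lemma wave_diff:
  assumes "coeffs_continuous T f" and "coeffs_continuous T g" and "t \<le> T"
  shows "wave (\<lambda>s k. f s k - g s k) t k = wave f t k - wave g t k"
  unfolding wave_def duh_diff[OF assms] by (simp add: algebra_simps)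

lemma wave_deriv_diff:
  assumes "coeffs_continuous T f" and "coeffs_continuous T g" and "t \<le> T"
  shows "wave_deriv (\<lambda>s k. f s k - g s k) t k = wave_deriv f t k - wave_deriv g t k"
  unfolding wave_deriv_def duh_diff[OF assms] by (simp add: field_simps)

lemma wave_deriv_cmult: "wave_deriv (\<lambda>s k. c * f s k) t k = c * wave_deriv f t k"
  by (simp add: wave_deriv_def duh_cmult algebra_simps)

text \<open>The factor \<open>ksq k\<close> is not bounded in \<open>k\<close>, so this is an
  estimate for single coefficients rather than a \<open>wbd\<close> statement; the remaining
  exponential weight absorbs the factor later.\<close>

lemma wave_deriv_bound:
  assumes "coeffs_continuous T f" and "0 \<le> t" "t \<le> T"
    and "\<And>s. 0 \<le> s \<Longrightarrow> s \<le> T \<Longrightarrow> cmod (f s k) * weight T s k \<le> a" and "0 \<le> a"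
  shows "cmod (wave_deriv f t k) * weight T t k \<le> ksq k * T * a"
proof -
  have "cmod (wave_deriv f t k) * weight T t k
      \<le> ksq k / 2 * (cmod (duh (\<lambda>k. - freq k) f t k) * weight T t k + cmod (duh freq f t k) * weight T t k)"
    using norm_triangle_ineq[of "duh (\<lambda>k. - freq k) f t k" "duh freq f t k"] weight_pos[of T t k]
    by (simp add: wave_deriv_def norm_mult norm_divide ksq_nonneg mult.assoc mult_left_mono flip: distrib_right)
  also have "\<dots> \<le> ksq k / 2 * (T * a + T * a)"
    using ksq_nonneg[of k] assms by (intro mult_left_mono add_mono duh_bound) auto
  finally show ?thesis by simp
qed

text \<open>Conjugation exchanges the two half waves, so a real source yields a real density and
  velocity.\<close>

lemma cnj_wave:
  assumes "\<And>s. 0 \<le> s \<Longrightarrow> s \<le> t \<Longrightarrow> f s (- k) = cnj (f s k)"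
  shows "wave f t (- k) = cnj (wave f t k)" and "wave_deriv f t (- k) = cnj (wave_deriv f t k)"
proof -
  have "duh (\<lambda>k. - freq k) f t (- k) = cnj (duh freq f t k)" "duh freq f t (- k) = cnj (duh (\<lambda>k. - freq k) f t k)"
    unfolding cnj_duh by (rule duh_cong; simp add: assms)+
  then show "wave f t (- k) = cnj (wave f t k)" "wave_deriv f t (- k) = cnj (wave_deriv f t k)"
    by (simp_all add: wave_def wave_deriv_def algebra_simps)
qed

lemma cnj_conv_flip: "conv u (flip u) t (- k) = cnj (conv u (flip u) t k)"
proof -
  have "conv u (flip u) t (- k) = (\<Sum>\<^sub>\<infinity>j. cnj (u t j * flip u t (k - j)))"
    unfolding conv_def
    by (rule infsum_reindex_bij_witness[where i = "\<lambda>j. j - k" and j = "\<lambda>j. j + k"])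
       (auto simp: flip_def algebra_simps)
  then show ?thesis
    unfolding conv_def by (simp only: infsum_cnj)
qed

section \<open>Picard iteration\<close>

text \<open>Completeness of the weighted norm along a geometrically convergent sequence: the limit
  is the telescoping series, and the majorants of the increments are summed over the steps.\<close>

lemma wbd_Cauchy_limit:
  fixes U :: "nat \<Rightarrow> real \<Rightarrow> ('d::finite) fc"
  assumes cont: "\<And>m. coeffs_continuous T (U m)"
    and step: "\<And>m. wbd T (C / 2 ^ m) (\<lambda>t k. U (Suc m) t k - U m t k)"
  shows "\<exists>u. \<forall>m. wbd T (2 * C / 2 ^ m) (\<lambda>t k. u t k - U m t k)"
proof -
  have "\<forall>m. \<exists>a. a summable_on UNIV \<and> infsum a UNIV \<le> C / 2 ^ m \<and> (\<forall>k. 0 \<le> a k) \<and>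
      (\<forall>t\<in>{0..T}. \<forall>k. cmod (U (Suc m) t k - U m t k) * weight T t k \<le> a k) \<and> (\<forall>k. a k \<le> C / 2 ^ m)"
  proof
    fix m
    show "\<exists>a. a summable_on UNIV \<and> infsum a UNIV \<le> C / 2 ^ m \<and> (\<forall>k. 0 \<le> a k) \<and>
      (\<forall>t\<in>{0..T}. \<forall>k. cmod (U (Suc m) t k - U m t k) * weight T t k \<le> a k) \<and> (\<forall>k. a k \<le> C / 2 ^ m)"
      by (rule wbdE[OF step[of m]]) auto
  qed
  from choice[OF this] obtain a where
    a: "a m summable_on UNIV" "infsum (a m) UNIV \<le> C / 2 ^ m" "0 \<le> a m k" "a m k \<le> C / 2 ^ m"
    and d: "t \<in> {0..T} \<Longrightarrow> cmod (U (Suc m) t k - U m t k) * weight T t k \<le> a m k" for m t k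
    by blast
  have geo: "(\<lambda>i. C / 2 ^ (i + m)) sums (2 * C / 2 ^ m)" for m
    using sums_mult[OF geometric_sums[of "1 / 2 :: real"], of "C / 2 ^ m"]
    by (simp add: power_add power_divide field_simps)
  have asum: "summable (\<lambda>i. a (i + m) k)" for m k
    by (rule summable_comparison_test[OF _ sums_summable[OF geo[of m]]]) (use a in auto)
  \<comment> \<open>Majorant of the whole tail from step \<open>m\<close> on. Its sum over
    frequencies is estimated on finite sets \<open>F\<close>, where exchanging the two sums is
    elementary.\<close>
  define A where "A m k = (\<Sum>i. a (i + m) k)" for m k
  have A0: "0 \<le> A m k" for m k
    unfolding A_def using a by (intro suminf_nonneg asum)
  have AF: "sum (A m) F \<le> 2 * C / 2 ^ m" if "finite F" for m F
  proof -
    have "sum (A m) F = (\<Sum>i. \<Sum>k\<in>F. a (i + m) k)"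
      unfolding A_def by (subst suminf_sum) (use asum in auto)
    also have "\<dots> \<le> (\<Sum>i. C / 2 ^ (i + m))"
    proof (rule suminf_le)
      show "summable (\<lambda>i. \<Sum>k\<in>F. a (i + m) k)"
        using asum by (rule summable_sum)
      show "(\<Sum>k\<in>F. a (i + m) k) \<le> C / 2 ^ (i + m)" for i
        by (rule order_trans[OF finite_sum_le_infsum a(2)]) (use a that in auto)
    qed (rule sums_summable[OF geo])
    also have "\<dots> = 2 * C / 2 ^ m"
      using geo[of m] by (simp add: sums_iff)
    finally show ?thesis .
  qed
  have As: "A m summable_on UNIV" for m
    by (rule nonneg_bdd_above_summable_on) (auto intro!: bdd_aboveI2 AF A0)
  have Ai: "infsum (A m) UNIV \<le> 2 * C / 2 ^ m" for m
    by (rule infsum_le_finite_sums[OF As AF])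
  define u where "u t k = U 0 t k + (\<Sum>i. U (Suc i) t k - U i t k)" for t k
  have main: "cmod (u t k - U m t k) * weight T t k \<le> A m k" if t: "t \<in> {0..T}" for t m k
  proof -
    let ?d = "\<lambda>i. U (Suc i) t k - U i t k"
    have dn: "norm (?d i * weight T t k) \<le> a i k" for i
      using d[OF t, of i k] weight_pos[of T t k] by (simp add: norm_mult)
    \<comment> \<open>Convergence is known for the weighted increments; dividing by the positive
      weight recovers the unweighted series.\<close>
    have sw: "summable (\<lambda>i. ?d i * weight T t k)"
      by (rule summable_comparison_test[OF _ asum[of 0 k]]) (use dn in auto)
    have sd: "summable ?d"
      using summable_mult2[OF sw, of "inverse (of_real (weight T t k))"] weight_pos[of T t k]
      by (simp add: mult.assoc)
    have "u t k - U m t k = (\<Sum>i. ?d (i + m))"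
      using suminf_split_initial_segment[OF sd, of m]
      by (simp add: u_def sum_lessThan_telescope[of "\<lambda>i. U i t k"])
    then have "cmod (u t k - U m t k) * weight T t k = norm ((\<Sum>i. ?d (i + m)) * weight T t k)"
      using weight_pos[of T t k] by (simp add: norm_mult)
    also have "\<dots> = norm (\<Sum>i. ?d (i + m) * weight T t k)"
      using sd by (subst suminf_mult2) (auto simp only: summable_iff_shift[of ?d m])
    also have "\<dots> \<le> (\<Sum>i. norm (?d (i + m) * weight T t k))"
      by (rule summable_norm, rule summable_comparison_test[OF _ asum[of m k]]) (use dn in auto)
    also have "\<dots> \<le> A m k"
      unfolding A_def
      by (rule suminf_le[OF dn _ asum], rule summable_comparison_test[OF _ asum[of m k]]) (use dn in auto)
    finally show ?thesis .
  qed
  have close: "cmod (u t k - U m t k) \<le> 2 * C / 2 ^ m" if t: "t \<in> {0..T}" for t m k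
  proof -
    have "cmod (u t k - U m t k) * 1 \<le> cmod (u t k - U m t k) * weight T t k"
      using t by (intro mult_left_mono weight_ge_1) auto
    then show ?thesis
      using main[OF t, of k m] AF[of "{k}" m] by simp
  qed
  have cu: "continuous_on {0..T} (\<lambda>t. u t k)" for k
  proof (rule uniform_limit_theorem)
    show "\<forall>\<^sub>F m in sequentially. continuous_on {0..T} (\<lambda>t. U m t k)"
      using cont by (simp add: coeffs_continuous_def)
    show "uniform_limit {0..T} (\<lambda>m t. U m t k) (\<lambda>t. u t k) sequentially"
    proof (rule uniform_limitI)
      fix e :: real assume "e > 0"
      have "(\<lambda>m. 2 * C / 2 ^ m) \<longlonglongrightarrow> 0"
        using tendsto_mult_right_zero[OF LIMSEQ_power_zero[of "1/2 :: real"], of "2 * C"]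
        by (simp add: power_divide)
      then have "\<forall>\<^sub>F m in sequentially. 2 * C / 2 ^ m < e"
        using \<open>e > 0\<close> by (rule order_tendstoD)
      then show "\<forall>\<^sub>F m in sequentially. \<forall>t\<in>{0..T}. dist (U m t k) (u t k) < e"
      proof eventually_elim
        case (elim m)
        show ?case
          using close[of _ k m] elim by (force simp: dist_norm norm_minus_commute)
      qed
    qed
  qed simp
  have "wbd T (2 * C / 2 ^ m) (\<lambda>t k. u t k - U m t k)" for m
    by (rule wbdI[OF _ As Ai A0])
       (use main in \<open>auto intro!: continuous_on_diff cu coeffs_continuousD[OF cont]\<close>)
  then show ?thesis by blast
qed

section \<open>Elimination of the density and the Picard map\<close>

definition acoustic :: "(real \<Rightarrow> ('d::finite) fc) \<Rightarrow> real \<Rightarrow> 'd fc" where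
  "acoustic u = wave (conv u (flip u))"

text \<open>With zero wave data the density is the function \<open>acoustic u\<close> of
  \<open>u\<close>, so the system reduces to one Duhamel equation for \<open>u\<close>, with
  \<open>v\<close> the free evolution of the data.\<close>

definition zakharov_map :: "(real \<Rightarrow> ('d::finite) fc) \<Rightarrow> (real \<Rightarrow> 'd fc) \<Rightarrow> real \<Rightarrow> 'd fc" where
  "zakharov_map v u t k = v t k - \<i> * duh ksq (conv (acoustic u) u) t k"

lemma wbd_intensity: "wbd T R u \<Longrightarrow> wbd T (R\<^sup>2) (conv u (flip u))"
  using wbd_conv[OF _ wbd_flip, of T R u R u] by (simp add: power2_eq_square)

lemma wbd_flip_diff:
  "wbd T D (\<lambda>t k. u t k - w t k) \<Longrightarrow> wbd T D (\<lambda>t k. flip u t k - flip w t k)"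
  by (drule wbd_flip) (simp add: flip_def[abs_def])

lemma wbd_intensity_diff:
  assumes "wbd T R u" and "wbd T R w" and "wbd T D (\<lambda>t k. u t k - w t k)"
  shows "wbd T (2 * R * D) (\<lambda>t k. conv u (flip u) t k - conv w (flip w) t k)"
  using conv_diff[OF assms(1,2) wbd_flip[OF assms(1)] wbd_flip[OF assms(2)] assms(3) wbd_flip_diff[OF assms(3)]]
  by (simp add: mult_ac)

lemma wbd_acoustic: "wbd T R u \<Longrightarrow> wbd T (R\<^sup>2) (acoustic u)"
  unfolding acoustic_def by (intro wbd_wave wbd_intensity)

lemma wbd_acoustic_diff:
  assumes "wbd T R u" and "wbd T R w" and "wbd T D (\<lambda>t k. u t k - w t k)"
  shows "wbd T (2 * R * D) (\<lambda>t k. acoustic u t k - acoustic w t k)"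
  by (rule wbd_cong[OF wbd_wave[OF wbd_intensity_diff[OF assms]]])
     (simp add: acoustic_def wave_diff[OF wbd_coeffs_continuous[OF wbd_intensity[OF assms(1)]]
         wbd_coeffs_continuous[OF wbd_intensity[OF assms(2)]]])

lemma wbd_zakharov_map_increment:
  assumes "wbd T R u" and "0 \<le> T"
  shows "wbd T (T * R ^ 3) (\<lambda>t k. zakharov_map v u t k - v t k)"
proof -
  have "wbd T (T * R ^ 3) (duh ksq (conv (acoustic u) u))"
    using wbd_duh[OF wbd_conv[OF wbd_acoustic[OF assms(1)] assms(1)] assms(2)]
    by (simp add: power2_eq_square power3_eq_cube mult.assoc)
  from wbd_cmult[OF this, of "- \<i>"] show ?thesis
    by (simp add: zakharov_map_def)
qed

text \<open>The nonlinearity is cubic: varying \<open>u\<close> inside the density costs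
  \<open>2 * R\<^sup>2 * D\<close>, varying the other factor costs \<open>R\<^sup>2 * D\<close>, and
  the time integral adds \<open>T\<close>.\<close>

lemma wbd_zakharov_map_diff:
  assumes "wbd T R u" and "wbd T R w" and "wbd T D (\<lambda>t k. u t k - w t k)" and "0 \<le> T"
  shows "wbd T (3 * T * R\<^sup>2 * D) (\<lambda>t k. zakharov_map v u t k - zakharov_map v w t k)"
proof -
  note cc = wbd_coeffs_continuous[OF wbd_conv[OF wbd_acoustic[OF assms(1)] assms(1)]]
    wbd_coeffs_continuous[OF wbd_conv[OF wbd_acoustic[OF assms(2)] assms(2)]]
  have "wbd T (2 * R * D * R + R\<^sup>2 * D) (\<lambda>t k. conv (acoustic u) u t k - conv (acoustic w) w t k)"
    by (intro conv_diff wbd_acoustic wbd_acoustic_diff assms)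
  from wbd_cmult[OF wbd_duh[OF this assms(4)], where c = "- \<i>"]
  have "wbd T (3 * T * R\<^sup>2 * D)
     (\<lambda>t k. - \<i> * duh ksq (\<lambda>t k. conv (acoustic u) u t k - conv (acoustic w) w t k) t k)"
    by (simp add: power2_eq_square algebra_simps)
  then show ?thesis
    by (rule wbd_cong) (simp add: zakharov_map_def duh_diff[OF cc] algebra_simps)
qed

text \<open>Picard iteration from zero. The smallness constant 24 makes the map preserve the ball of
  radius \<open>2 * r\<close> and, since \<open>3 * T * (2 * r)\<^sup>2 \<le> 1/2\<close>, halve
  distances there.\<close>

lemma zakharov_map_fixpoint:
  assumes "0 \<le> T" and v: "wbd T r v" and small: "24 * T * r\<^sup>2 \<le> 1"
  shows "\<exists>u. wbd T (4 * r) u \<and> (\<forall>t\<in>{0..T}. \<forall>k. u t k = zakharov_map v u t k)"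
proof -
  have r: "0 \<le> r"
    using v by (rule wbdE)
  have self: "wbd T (2 * r) (zakharov_map v u)" if "wbd T (2 * r) u" for u
  proof -
    have "T * (2 * r) ^ 3 = (24 * T * r\<^sup>2) * (r / 3)"
      by (simp add: power2_eq_square power3_eq_cube)
    also have "\<dots> \<le> 1 * (r / 3)"
      using small r by (intro mult_right_mono) auto
    finally have "T * (2 * r) ^ 3 + r \<le> 2 * r"
      using r by simp
    from wbd_mono[OF wbd_add[OF wbd_zakharov_map_increment[where v = v, OF that assms(1)] v] this]
    show ?thesis by simp
  qed
  \<comment> \<open>Stated for general \<open>R\<close> and \<open>q\<close>: the iterates use
    \<open>R = 2 * r\<close> with \<open>q = 1/2\<close>, while the limit is only known to lie in
    radius \<open>4 * r\<close>, where the Lipschitz constant is at most 2.\<close>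
  have contr: "wbd T (q * D) (\<lambda>t k. zakharov_map v u t k - zakharov_map v w t k)"
    if "wbd T R u" "wbd T R w" "wbd T D (\<lambda>t k. u t k - w t k)" "3 * T * R\<^sup>2 \<le> q" for q u w D R
  proof -
    have "0 \<le> D" using that(3) by (rule wbdE)
    then show ?thesis
      using wbd_mono[OF wbd_zakharov_map_diff[OF that(1-3) assms(1)]] that(4) by (simp add: mult_right_mono)
  qed
  define U where "U m = (zakharov_map v ^^ m) (\<lambda>t k. 0)" for m
  have U0: "U 0 = (\<lambda>t k. 0)" and US: "U (Suc m) = zakharov_map v (U m)" for m
    by (simp_all add: U_def)
  have UR: "wbd T (2 * r) (U m)" for m
    by (induction m) (use r in \<open>auto simp: U0 US intro!: wbd_zero self\<close>)
  have step: "wbd T (2 * r / 2 ^ m) (\<lambda>t k. U (Suc m) t k - U m t k)" for m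
  proof (induction m)
    case 0
    then show ?case using UR[of 1] by (simp add: U0)
  next
    case (Suc m)
    have "wbd T (1 / 2 * (2 * r / 2 ^ m)) (\<lambda>t k. U (Suc (Suc m)) t k - U (Suc m) t k)"
      using contr[OF UR UR Suc, of "1/2"] small by (simp add: US power_mult_distrib)
    then show ?case by simp
  qed
  obtain u where u: "\<And>m. wbd T (2 * (2 * r) / 2 ^ m) (\<lambda>t k. u t k - U m t k)"
    using wbd_Cauchy_limit[OF wbd_coeffs_continuous[OF UR] step] by blast
  have u4: "wbd T (4 * r) u"
    using u[of 0] by (simp add: U0)
  have "u t k = zakharov_map v u t k" if t: "t \<in> {0..T}" for t k
  proof -
    \<comment> \<open>Passing through \<open>U (Suc m)\<close>: the first difference is at most
      \<open>2 * r / 2 ^ m\<close>, and Lipschitz constant 2 turns \<open>4 * r / 2 ^ m\<close> into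
      \<open>8 * r / 2 ^ m\<close>.\<close>
    have "cmod (u t k - zakharov_map v u t k) \<le> 10 * r / 2 ^ m" for m
    proof -
      have "wbd T (2 * (2 * (2 * r) / 2 ^ m)) (\<lambda>t k. zakharov_map v u t k - zakharov_map v (U m) t k)"
        using small r by (intro contr[OF u4 wbd_mono[OF UR] u]) (auto simp: power_mult_distrib)
      from wbd_norm_le[OF wbd_diff[OF u[of "Suc m"] this], of t k] t show ?thesis
        by (simp add: US)
    qed
    moreover have "(\<lambda>m. 10 * r / 2 ^ m) \<longlonglongrightarrow> 0"
      using tendsto_mult_right_zero[OF LIMSEQ_power_zero[of "1/2 :: real"], of "10 * r"]
      by (simp add: power_divide)
    ultimately have "cmod (u t k - zakharov_map v u t k) \<le> 0"
      by (intro LIMSEQ_le_const) auto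
    then show ?thesis by simp
  qed
  with u4 show ?thesis by blast
qed

section \<open>From exponential weights to Sobolev norms of every order\<close>

lemma powr_exp_bounded:
  fixes q :: real
  shows "\<exists>K\<ge>0. \<forall>x\<ge>0. (1 + x\<^sup>2) powr q \<le> K * exp x"
proof -
  obtain n :: nat where n: "q \<le> real n" "0 < n"
    using real_arch_simple[of "max q 1"] by force
  \<comment> \<open>The exponent is doubled because
    \<open>1 + x\<^sup>2 \<le> (1 + x)\<^sup>2\<close>; then
    \<open>(1 + x / N) ^ N \<le> exp x\<close> gives the constant \<open>N ^ N\<close>.\<close>
  define N where "N = 2 * n"
  have N: "0 < N" using n by (simp add: N_def)
  have "(1 + x\<^sup>2) powr q \<le> real N ^ N * exp x" if "0 \<le> x" for x :: real
  proof -
    have "(1 + x\<^sup>2) powr q \<le> (1 + x\<^sup>2) powr n"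
      using n by (intro powr_mono) auto
    also have "\<dots> = (1 + x\<^sup>2) ^ n"
      by (rule powr_realpow) (simp add: add_pos_nonneg)
    also have "\<dots> \<le> ((1 + x)\<^sup>2) ^ n"
      using that by (intro power_mono) (auto simp: power2_eq_square algebra_simps)
    also have "\<dots> = (1 + x) ^ N"
      by (simp add: N_def power_mult)
    also have "\<dots> \<le> (real N * (1 + x / N)) ^ N"
      using N that by (intro power_mono) (auto simp: field_simps)
    also have "\<dots> \<le> real N ^ N * exp x"
      unfolding power_mult_distrib using N that
      by (intro mult_left_mono exp_ge_one_plus_x_over_n_power_n) auto
    finally show ?thesis .
  qed
  then show ?thesis
    by (intro exI[of _ "real N ^ N"]) auto
qed

text \<open>The factor \<open>1 + ksq k\<close> in the hypothesis makes room for the velocity, which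
  loses two derivatives. Squared, it raises the Sobolev exponent to \<open>\<sigma> + 2\<close>, and
  one factor \<open>a k\<close> is replaced by \<open>r\<close> to pass from square sums to
  sums.\<close>

lemma sobolev_bound:
  fixes \<sigma> :: real
  shows "\<exists>K. \<forall>(f :: ('d::finite) fc) a r. a summable_on UNIV \<longrightarrow> infsum a UNIV \<le> r \<longrightarrow> (\<forall>k. 0 \<le> a k) \<longrightarrow>
     (\<forall>k. cmod (f k) * exp (freq k) \<le> (1 + ksq k) * a k) \<longrightarrow> in_sob \<sigma> f \<and> sob_nsq \<sigma> f \<le> K * r\<^sup>2"
proof -
  obtain K where "0 \<le> K" and K: "\<And>x. 0 \<le> x \<Longrightarrow> (1 + x\<^sup>2) powr (\<sigma> + 2) \<le> K * exp x"
    using powr_exp_bounded[of "\<sigma> + 2"] by blast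
  have "in_sob \<sigma> f \<and> sob_nsq \<sigma> f \<le> K * r\<^sup>2"
    if a: "a summable_on UNIV" "infsum a UNIV \<le> r" "\<And>k. 0 \<le> a k"
      and f: "\<And>k. cmod (f k) * exp (freq k) \<le> (1 + ksq k) * a k" for f :: "'d fc" and a r
  proof -
    have ar: "a k \<le> r" for k
      using finite_sum_le_infsum[of a UNIV "{k}"] a by simp
    have r0: "0 \<le> r"
      using ar[of 0] a(3)[of 0] by linarith
    have le: "(1 + ksq k) powr \<sigma> * (cmod (f k))\<^sup>2 \<le> K * r * a k" for k
    proof -
      have "(cmod (f k) * exp (freq k))\<^sup>2 \<le> ((1 + ksq k) * a k)\<^sup>2"
        by (intro power_mono f) simp
      moreover have "exp (- 2 * freq k) = 1 / (exp (freq k))\<^sup>2"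
        by (simp add: exp_minus field_simps flip: exp_double)
      ultimately have 1: "(cmod (f k))\<^sup>2 \<le> (1 + ksq k)\<^sup>2 * (a k)\<^sup>2 * exp (- 2 * freq k)"
        by (simp add: power_mult_distrib pos_le_divide_eq)
      have "(1 + ksq k) powr \<sigma> * (cmod (f k))\<^sup>2
          \<le> (1 + ksq k) powr \<sigma> * ((1 + ksq k)\<^sup>2 * (a k)\<^sup>2 * exp (- 2 * freq k))"
        using 1 by (intro mult_left_mono) auto
      also have "\<dots> = (1 + ksq k) powr (\<sigma> + 2) * exp (- 2 * freq k) * (a k)\<^sup>2"
        using ksq_nonneg[of k] by (simp add: powr_add)
      also have "\<dots> \<le> K * exp (freq k) * exp (- 2 * freq k) * (a k)\<^sup>2"
        using K[OF freq_nonneg[of k]] by (intro mult_right_mono) (auto simp: freq_squared)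
      also have "\<dots> = K * exp (- freq k) * (a k)\<^sup>2"
        by (simp add: mult.assoc flip: exp_add)
      also have "\<dots> \<le> K * 1 * (r * a k)"
        using \<open>0 \<le> K\<close> a(3)[of k] ar[of k] freq_nonneg[of k]
        by (intro mult_mono) (auto simp: power2_eq_square intro!: mult_right_mono)
      finally show ?thesis by simp
    qed
    have s: "in_sob \<sigma> f"
      unfolding in_sob_def
      by (rule summable_on_comparison_test[OF summable_on_cmult_right[OF a(1)], of _ "K * r"])
         (use le in auto)
    have "sob_nsq \<sigma> f \<le> (\<Sum>\<^sub>\<infinity>k. K * r * a k)"
      unfolding sob_nsq_def using s[unfolded in_sob_def] le
      by (intro infsum_mono summable_on_cmult_right a)
    also have "\<dots> = K * r * infsum a UNIV"
      by (rule infsum_cmult_right')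
    also have "\<dots> \<le> K * r * r"
      using \<open>0 \<le> K\<close> r0 a by (intro mult_left_mono) auto
    finally show ?thesis
      using s by (simp add: power2_eq_square mult.assoc)
  qed
  then show ?thesis by blast
qed

section \<open>Small classical solutions\<close>

definition free_evolution :: "('d::finite) fc \<Rightarrow> real \<Rightarrow> 'd fc" where
  "free_evolution u0 t k = cis (- ksq k * t) * u0 k"

lemma wbd_free_evolution:
  assumes "(\<lambda>k. cmod (u0 k) * exp ((1 + T) * freq k)) summable_on UNIV"
  shows "wbd T (\<Sum>\<^sub>\<infinity>k. cmod (u0 k) * exp ((1 + T) * freq k)) (free_evolution u0)"
proof (rule wbdI[OF _ assms order_refl])
  show "continuous_on {0..T} (\<lambda>t. free_evolution u0 t k)" for k
    unfolding free_evolution_def by (intro continuous_intros)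
  show "cmod (free_evolution u0 t k) * weight T t k \<le> cmod (u0 k) * exp ((1 + T) * freq k)"
    if "0 \<le> t" "t \<le> T" for t k
    using that freq_nonneg[of k]
    by (auto simp: free_evolution_def norm_mult weight_def intro!: mult_left_mono mult_right_mono)
qed simp

lemma free_evolution_has_vector_derivative:
  "((\<lambda>t. free_evolution u0 t k) has_vector_derivative - \<i> * of_real (ksq k) * free_evolution u0 t k)
     (at t within S)"
  unfolding free_evolution_def
  by (rule has_vector_derivative_eq_rhs[OF has_vector_derivative_mult_left[OF cis_has_vector_derivative]]) simp

lemma sobolev_bound_wbd:
  fixes g :: "real \<Rightarrow> ('d::finite) fc"
  assumes "wbd T r f" and "0 \<le> c"
    and g: "\<And>a t k. (\<And>s. 0 \<le> s \<Longrightarrow> s \<le> T \<Longrightarrow> cmod (f s k) * weight T s k \<le> a) \<Longrightarrow> 0 \<le> a \<Longrightarrow>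
       0 \<le> t \<Longrightarrow> t \<le> T \<Longrightarrow> cmod (g t k) * weight T t k \<le> (1 + ksq k) * (c * a)"
  shows "\<exists>K. \<forall>t\<in>{0..T}. in_sob \<sigma> (g t) \<and> sob_nsq \<sigma> (g t) \<le> K"
proof -
  obtain a where a: "a summable_on UNIV" "infsum a UNIV \<le> r" "\<And>k. 0 \<le> a k"
    "\<And>t k. 0 \<le> t \<Longrightarrow> t \<le> T \<Longrightarrow> cmod (f t k) * weight T t k \<le> a k"
    using assms(1) by (elim wbdE) blast
  obtain K where K: "\<And>(f :: 'd fc) a r. a summable_on UNIV \<Longrightarrow> infsum a UNIV \<le> r \<Longrightarrow> (\<And>k. 0 \<le> a k) \<Longrightarrow>
     (\<And>k. cmod (f k) * exp (freq k) \<le> (1 + ksq k) * a k) \<Longrightarrow> in_sob \<sigma> f \<and> sob_nsq \<sigma> f \<le> K * r\<^sup>2"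
    using sobolev_bound[of \<sigma>] by blast
  have "in_sob \<sigma> (g t) \<and> sob_nsq \<sigma> (g t) \<le> K * (c * r)\<^sup>2" if t: "t \<in> {0..T}" for t
  proof (rule K)
    show "(\<lambda>k. c * a k) summable_on UNIV"
      using a by (intro summable_on_cmult_right)
    show "(\<Sum>\<^sub>\<infinity>k. c * a k) \<le> c * r"
      using a \<open>0 \<le> c\<close> by (simp add: infsum_cmult_right' mult_left_mono)
    show "0 \<le> c * a k" for k
      using a \<open>0 \<le> c\<close> by simp
    show "cmod (g t k) * exp (freq k) \<le> (1 + ksq k) * (c * a k)" for k
    proof -
      have "1 * freq k \<le> (1 + T - t) * freq k"
        using t freq_nonneg[of k] by (intro mult_right_mono) auto
      then have "cmod (g t k) * exp (freq k) \<le> cmod (g t k) * weight T t k"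
        unfolding weight_def by (intro mult_left_mono) auto
      also have "\<dots> \<le> (1 + ksq k) * (c * a k)"
        using t by (intro g a) auto
      finally show ?thesis .
    qed
  qed
  then show ?thesis by blast
qed

lemma sobolev_bound_of_wbd:
  fixes f :: "real \<Rightarrow> ('d::finite) fc"
  assumes "wbd T r f"
  shows "\<exists>K. \<forall>t\<in>{0..T}. in_sob \<sigma> (f t) \<and> sob_nsq \<sigma> (f t) \<le> K"
proof (rule sobolev_bound_wbd[OF assms, of 1])
  fix a t k
  assume *: "\<And>s. 0 \<le> s \<Longrightarrow> s \<le> T \<Longrightarrow> cmod (f s k) * weight T s k \<le> a" "0 \<le> a" "0 \<le> t" "t \<le> T"
  have "a \<le> (1 + ksq k) * a"
    using *(2) ksq_nonneg[of k] by (simp add: distrib_right)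
  then show "cmod (f t k) * weight T t k \<le> (1 + ksq k) * (1 * a)"
    using *(1)[OF *(3,4)] by simp
qed simp

lemma sobolev_bound_wave_deriv:
  fixes f :: "real \<Rightarrow> ('d::finite) fc"
  assumes "wbd T r f" and "0 \<le> T"
  shows "\<exists>K. \<forall>t\<in>{0..T}. in_sob \<sigma> (wave_deriv f t) \<and> sob_nsq \<sigma> (wave_deriv f t) \<le> K"
proof (rule sobolev_bound_wbd[OF assms])
  fix a t k
  assume *: "\<And>s. 0 \<le> s \<Longrightarrow> s \<le> T \<Longrightarrow> cmod (f s k) * weight T s k \<le> a" "0 \<le> a" "0 \<le> t" "t \<le> T"
  have "cmod (wave_deriv f t k) * weight T t k \<le> ksq k * T * a"
    by (rule wave_deriv_bound[OF wbd_coeffs_continuous[OF assms(1)]]) (use * in auto)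
  also have "\<dots> \<le> (1 + ksq k) * (T * a)"
    using *(2) assms(2) by (simp add: distrib_right)
  finally show "cmod (wave_deriv f t k) * weight T t k \<le> (1 + ksq k) * (T * a)" .
qed

definition trajectory :: "(real \<Rightarrow> ('d::finite) fc) \<Rightarrow> 'd traj" where
  "trajectory u t = (u t, acoustic u t, wave_deriv (conv u (flip u)) t)"

text \<open>Differentiating the Duhamel formulas returns the equations, and the exponential decay of
  the coefficients bounds all Sobolev norms uniformly in time.\<close>

lemma classical_sol_of_fixpoint:
  fixes u :: "real \<Rightarrow> ('d::finite) fc"
  assumes "0 \<le> T" and u: "wbd T R u"
    and fp: "\<And>t k. 0 \<le> t \<Longrightarrow> t \<le> T \<Longrightarrow> u t k = zakharov_map (free_evolution u0) u t k"
  shows "classical_sol T (u0, \<lambda>k. 0, \<lambda>k. 0) (trajectory u)"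
proof -
  let ?n = "acoustic u" and ?g = "conv u (flip u)"
  note cg = wbd_coeffs_continuous[OF wbd_intensity[OF u]]
  have init: "trajectory u 0 = (u0, \<lambda>k. 0, \<lambda>k. 0)"
    using fp[of 0] assms(1)
    by (auto simp: trajectory_def zakharov_map_def free_evolution_def acoustic_def wave_def wave_deriv_def fun_eq_iff)
  have sob: "\<exists>C. \<forall>t\<in>{0..T}. in_sob \<sigma> (u t) \<and> in_sob \<sigma> (?n t) \<and> in_sob \<sigma> (wave_deriv ?g t) \<and>
      sob_nsq \<sigma> (u t) + sob_nsq \<sigma> (?n t) + sob_nsq \<sigma> (wave_deriv ?g t) \<le> C" for \<sigma>
  proof -
    obtain K1 K2 K3 where
      "\<forall>t\<in>{0..T}. in_sob \<sigma> (u t) \<and> sob_nsq \<sigma> (u t) \<le> K1"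
      "\<forall>t\<in>{0..T}. in_sob \<sigma> (?n t) \<and> sob_nsq \<sigma> (?n t) \<le> K2"
      "\<forall>t\<in>{0..T}. in_sob \<sigma> (wave_deriv ?g t) \<and> sob_nsq \<sigma> (wave_deriv ?g t) \<le> K3"
      using sobolev_bound_of_wbd[OF u] sobolev_bound_of_wbd[OF wbd_acoustic[OF u]]
        sobolev_bound_wave_deriv[OF wbd_intensity[OF u] assms(1)] by metis
    then show ?thesis
      by (intro exI[of _ "K1 + K2 + K3"]) (auto intro!: add_mono)
  qed
  have real: "real_fc (?n t)" "real_fc (wave_deriv ?g t)" for t
    unfolding real_fc_def acoustic_def by (intro allI cnj_wave cnj_conv_flip)+
  have du: "((\<lambda>\<tau>. u \<tau> k) has_vector_derivative
       (- \<i> * (of_real (ksq k) * u t k + (\<Sum>\<^sub>\<infinity>j. ?n t j * u t (k - j))))) (at t within {0..T})"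
    if t: "t \<in> {0..T}" for t k
  proof -
    note cn = wbd_coeffs_continuous[OF wbd_conv[OF wbd_acoustic[OF u] u]]
    have "((\<lambda>\<tau>. zakharov_map (free_evolution u0) u \<tau> k) has_vector_derivative
       (- \<i> * of_real (ksq k) * free_evolution u0 t k
        - \<i> * (- \<i> * of_real (ksq k) * duh ksq (conv ?n u) t k + conv ?n u t k))) (at t within {0..T})"
      unfolding zakharov_map_def
      by (intro has_vector_derivative_diff free_evolution_has_vector_derivative has_vector_derivative_mult_right
          duh_has_vector_derivative cn t)
    note D = this
    have ut: "u t k = free_evolution u0 t k - \<i> * duh ksq (conv ?n u) t k"
      using fp[of t k] t by (simp add: zakharov_map_def)
    have "((\<lambda>\<tau>. zakharov_map (free_evolution u0) u \<tau> k) has_vector_derivative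
       (- \<i> * (of_real (ksq k) * u t k + (\<Sum>\<^sub>\<infinity>j. ?n t j * u t (k - j))))) (at t within {0..T})"
      by (rule has_vector_derivative_eq_rhs[OF D]) (subst ut, simp add: conv_def algebra_simps)
    then show ?thesis
      \<comment> \<open>The fixed point identity holds on \<open>{0..T}\<close> only, which suffices
        for the derivative within that interval.\<close>
      by (rule has_vector_derivative_transform[OF t, rotated]) (use fp in auto)
  qed
  have g: "(\<Sum>\<^sub>\<infinity>j. u t j * cnj (u t (j - k))) = ?g t k" for t k
    by (simp add: conv_def flip_def)
  show ?thesis
    unfolding classical_sol_def g
    by (intro conjI allI ballI)
       (use init sob real du wave_has_vector_derivative[OF cg] wave_deriv_has_vector_derivative[OF cg]
        in \<open>simp_all add: trajectory_def acoustic_def g\<close>)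
qed

lemma conv_free_evolution_scale:
  "conv (free_evolution (\<lambda>k. of_real \<epsilon> * u0 k)) (flip (free_evolution (\<lambda>k. of_real \<epsilon> * u0 k))) t k
     = of_real (\<epsilon>\<^sup>2) * conv (free_evolution u0) (flip (free_evolution u0)) t k"
proof -
  have "conv (free_evolution (\<lambda>k. of_real \<epsilon> * u0 k)) (flip (free_evolution (\<lambda>k. of_real \<epsilon> * u0 k))) t k
     = (\<Sum>\<^sub>\<infinity>j. of_real (\<epsilon>\<^sup>2) * (free_evolution u0 t j * flip (free_evolution u0) t (k - j)))"
    unfolding conv_def by (rule infsum_cong) (simp add: free_evolution_def flip_def power2_eq_square)
  then show ?thesis
    by (simp add: conv_def infsum_cmult_right')
qed

text \<open>The solution differs from the free evolution by order \<open>\<epsilon> ^ 3\<close>, so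
  the squared moduli differ by order \<open>\<epsilon> ^ 4\<close>; the velocity is linear in the
  squared modulus, whose free part scales exactly like \<open>\<epsilon>\<^sup>2\<close>.\<close>

proposition small_classical_solutions:
  fixes u0 :: "('d::finite) fc"
  assumes "0 < T" and sm: "(\<lambda>k. cmod (u0 k) * exp ((1 + T) * freq k)) summable_on UNIV"
  shows "\<exists>\<epsilon>0>0. \<exists>C. \<forall>\<epsilon>. 0 < \<epsilon> \<longrightarrow> \<epsilon> \<le> \<epsilon>0 \<longrightarrow> (\<exists>U. classical_sol T (dscale \<epsilon> (u0, \<lambda>k. 0, \<lambda>k. 0)) U \<and>
     (\<forall>t\<in>{0..T}. \<forall>k. cmod (snd (snd (U t)) k
        - of_real (\<epsilon>\<^sup>2) * wave_deriv (conv (free_evolution u0) (flip (free_evolution u0))) t k)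
           \<le> ksq k * C * \<epsilon> ^ 4))"
proof -
  define r0 where "r0 = (\<Sum>\<^sub>\<infinity>k. cmod (u0 k) * exp ((1 + T) * freq k))"
  have r0: "0 \<le> r0"
    unfolding r0_def by (intro infsum_nonneg) simp
  \<comment> \<open>Being at most 1, \<open>\<epsilon>0\<close> dominates
    \<open>\<epsilon>\<^sup>2\<close>, and the denominator then yields the smallness condition of
    the fixed point for \<open>\<epsilon> * r0\<close>.\<close>
  define \<epsilon>0 where "\<epsilon>0 = 1 / (1 + 24 * T * r0\<^sup>2)"
  have d0: "0 < 1 + 24 * T * r0\<^sup>2"
    using assms(1) by (intro add_pos_nonneg) auto
  have e0: "0 < \<epsilon>0" "\<epsilon>0 \<le> 1" "24 * T * r0\<^sup>2 * \<epsilon>0 \<le> 1"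
    using d0 assms(1) by (auto simp: \<epsilon>0_def field_simps)
  let ?g0 = "conv (free_evolution u0) (flip (free_evolution u0))"
  have "\<exists>U. classical_sol T (dscale \<epsilon> (u0, \<lambda>k. 0, \<lambda>k. 0)) U \<and>
     (\<forall>t\<in>{0..T}. \<forall>k. cmod (snd (snd (U t)) k - of_real (\<epsilon>\<^sup>2) * wave_deriv ?g0 t k)
        \<le> ksq k * (T * (512 * T * r0 ^ 4)) * \<epsilon> ^ 4)" if e: "0 < \<epsilon>" "\<epsilon> \<le> \<epsilon>0" for \<epsilon>
  proof -
    define w0 where "w0 = (\<lambda>k. of_real \<epsilon> * u0 k)"
    define v where "v = free_evolution w0"
    have v: "wbd T (\<epsilon> * r0) v"
    proof -
      have "(\<lambda>k. cmod (w0 k) * exp ((1 + T) * freq k)) = (\<lambda>k. \<epsilon> * (cmod (u0 k) * exp ((1 + T) * freq k)))"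
        using e by (simp add: w0_def norm_mult mult.assoc)
      then show ?thesis
        using wbd_free_evolution[of w0 T] sm unfolding v_def r0_def
        by (simp add: summable_on_cmult_right infsum_cmult_right')
    qed
    have "\<epsilon> * \<epsilon> \<le> \<epsilon>0 * 1"
      using e e0 by (intro mult_mono) auto
    then have "24 * T * r0\<^sup>2 * \<epsilon>\<^sup>2 \<le> 24 * T * r0\<^sup>2 * \<epsilon>0"
      using assms(1) by (intro mult_left_mono) (auto simp: power2_eq_square)
    then have "24 * T * (\<epsilon> * r0)\<^sup>2 \<le> 1"
      using e0 by (simp add: power_mult_distrib mult_ac)
    then obtain u where u: "wbd T (4 * (\<epsilon> * r0)) u"
      and fp: "\<And>t k. 0 \<le> t \<Longrightarrow> t \<le> T \<Longrightarrow> u t k = zakharov_map v u t k"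
      using zakharov_map_fixpoint[OF _ v] assms(1) by (meson atLeastAtMost_iff less_imp_le)
    \<comment> \<open>The intensity estimate \<open>2 * R * D\<close> with
      \<open>R = 4 * \<epsilon> * r0\<close> and \<open>D = T * R ^ 3\<close>; the constant is 2
      times 4 times 64.\<close>
    define q where "q = 512 * T * r0 ^ 4 * \<epsilon> ^ 4"
    have "wbd T (T * (4 * (\<epsilon> * r0)) ^ 3) (\<lambda>t k. u t k - v t k)"
      by (rule wbd_cong[OF wbd_zakharov_map_increment[OF u, of v]]) (use fp assms(1) in auto)
    from wbd_intensity_diff[OF u wbd_mono[OF v] this]
    have gd: "wbd T q (\<lambda>t k. conv u (flip u) t k - conv v (flip v) t k)"
      using e r0 by (simp add: q_def power_mult_distrib power3_eq_cube power4_eq_xxxx mult_ac)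
    have cs: "classical_sol T (dscale \<epsilon> (u0, \<lambda>k. 0, \<lambda>k. 0)) (trajectory u)"
      using classical_sol_of_fixpoint[OF _ u fp[unfolded v_def]] assms(1) by (simp add: dscale_def w0_def)
    have cv: "conv v (flip v) = (\<lambda>t k. of_real (\<epsilon>\<^sup>2) * ?g0 t k)"
      unfolding v_def w0_def by (intro ext conv_free_evolution_scale)
    have "cmod (snd (snd (trajectory u t)) k - of_real (\<epsilon>\<^sup>2) * wave_deriv ?g0 t k)
        \<le> ksq k * (T * (512 * T * r0 ^ 4)) * \<epsilon> ^ 4" if t: "t \<in> {0..T}" for t k
    proof -
      obtain a where a: "\<And>k. 0 \<le> a k" "\<And>k. a k \<le> q"
        "\<And>t k. 0 \<le> t \<Longrightarrow> t \<le> T \<Longrightarrow> cmod (conv u (flip u) t k - conv v (flip v) t k) * weight T t k \<le> a k"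
        using gd by (elim wbdE) blast
      let ?m = "wave_deriv (\<lambda>t k. conv u (flip u) t k - conv v (flip v) t k) t k"
      have "cmod ?m * 1 \<le> cmod ?m * weight T t k"
        using t by (intro mult_left_mono weight_ge_1) auto
      also have "\<dots> \<le> ksq k * T * a k"
        by (rule wave_deriv_bound[OF wbd_coeffs_continuous[OF gd]]) (use t a in auto)
      also have "\<dots> \<le> ksq k * T * q"
        using a assms(1) ksq_nonneg[of k] by (intro mult_left_mono) auto
      also have "?m = wave_deriv (conv u (flip u)) t k - of_real (\<epsilon>\<^sup>2) * wave_deriv ?g0 t k"
        using wave_deriv_diff[OF wbd_coeffs_continuous[OF wbd_intensity[OF u]]
            wbd_coeffs_continuous[OF wbd_intensity[OF v]], of t k] t
        by (simp only: cv wave_deriv_cmult atLeastAtMost_iff)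
      finally show ?thesis
        by (simp add: trajectory_def q_def mult_ac)
    qed
    with cs show ?thesis by blast
  qed
  with e0(1) show ?thesis by blast
qed

section \<open>Second derivatives of Fourier coefficients\<close>

lemma sob_nsq_nonneg: "0 \<le> sob_nsq s f"
  unfolding sob_nsq_def by (intro infsum_nonneg) simp

lemma sob_nsq_coeff:
  assumes "in_sob s f"
  shows "(1 + ksq k) powr s * (cmod (f k))\<^sup>2 \<le> sob_nsq s f"
  using finite_sum_le_infsum[of "\<lambda>k. (1 + ksq k) powr s * (cmod (f k))\<^sup>2" UNIV "{k}"] assms
  by (simp add: sob_nsq_def in_sob_def)

lemma in_sob_cmult: "in_sob s f \<Longrightarrow> in_sob s (\<lambda>k. c * f k)"
  unfolding in_sob_def
  by (drule summable_on_cmult_right[where c = "(cmod c)\<^sup>2"]) (simp add: norm_mult power_mult_distrib mult_ac)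

lemma sob_nsq_cmult: "sob_nsq s (\<lambda>k. c * f k) = (cmod c)\<^sup>2 * sob_nsq s f"
proof -
  have "sob_nsq s (\<lambda>k. c * f k) = (\<Sum>\<^sub>\<infinity>k. (cmod c)\<^sup>2 * ((1 + ksq k) powr s * (cmod (f k))\<^sup>2))"
    unfolding sob_nsq_def by (rule infsum_cong) (simp add: norm_mult power_mult_distrib mult_ac)
  then show ?thesis
    by (simp add: sob_nsq_def infsum_cmult_right')
qed

text \<open>The crude pointwise bound of a squared sum by twice the sum of squares replaces the
  triangle inequality; for the boundedness of trajectories the constant is irrelevant.\<close>

lemma sob_add:
  assumes "in_sob s f" and "in_sob s g"
  shows "in_sob s (\<lambda>k. f k + g k)" and "sob_nsq s (\<lambda>k. f k + g k) \<le> 2 * sob_nsq s f + 2 * sob_nsq s g"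
proof -
  let ?w = "\<lambda>f k. (1 + ksq k) powr s * (cmod (f k))\<^sup>2"
  have f: "?w f summable_on UNIV" and g: "?w g summable_on UNIV"
    using assms by (simp_all add: in_sob_def)
  have le: "?w (\<lambda>k. f k + g k) k \<le> 2 * ?w f k + 2 * ?w g k" for k
  proof -
    have "(cmod (f k + g k))\<^sup>2 \<le> (cmod (f k) + cmod (g k))\<^sup>2"
      by (intro power_mono norm_triangle_ineq) simp
    also have "\<dots> \<le> 2 * (cmod (f k))\<^sup>2 + 2 * (cmod (g k))\<^sup>2"
      using sum_squares_ge_zero[of "cmod (f k) - cmod (g k)" 0] by (simp add: power2_eq_square algebra_simps)
    finally have "?w (\<lambda>k. f k + g k) k \<le> (1 + ksq k) powr s * (2 * (cmod (f k))\<^sup>2 + 2 * (cmod (g k))\<^sup>2)"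
      by (intro mult_left_mono) auto
    then show ?thesis by (simp add: algebra_simps)
  qed
  have s: "(\<lambda>k. 2 * ?w f k + 2 * ?w g k) summable_on UNIV"
    by (intro summable_on_add summable_on_cmult_right f g)
  show 1: "in_sob s (\<lambda>k. f k + g k)"
    unfolding in_sob_def by (rule summable_on_comparison_test[OF s]) (use le in auto)
  have "sob_nsq s (\<lambda>k. f k + g k) \<le> (\<Sum>\<^sub>\<infinity>k. 2 * ?w f k + 2 * ?w g k)"
    unfolding sob_nsq_def by (intro infsum_mono s 1[unfolded in_sob_def] le)
  also have "\<dots> = 2 * sob_nsq s f + 2 * sob_nsq s g"
    unfolding sob_nsq_def by (simp add: infsum_add summable_on_cmult_right f g infsum_cmult_right')
  finally show "sob_nsq s (\<lambda>k. f k + g k) \<le> 2 * sob_nsq s f + 2 * sob_nsq s g" .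
qed

lemma Hnorm_squared: "(Hnorm s l x)\<^sup>2 = sob_nsq s (fst x) + sob_nsq l (fst (snd x)) + sob_nsq (l - 1) (snd (snd x))"
  unfolding Hnorm_def by (intro real_sqrt_pow2 add_nonneg_nonneg sob_nsq_nonneg)

lemma Hnorm_nonneg: "0 \<le> Hnorm s l x"
  unfolding Hnorm_def by (intro real_sqrt_ge_zero add_nonneg_nonneg sob_nsq_nonneg)

lemma Hnorm_dscale: "Hnorm s l (dscale a x) = \<bar>a\<bar> * Hnorm s l x"
proof -
  have "(Hnorm s l (dscale a x))\<^sup>2 = (\<bar>a\<bar> * Hnorm s l x)\<^sup>2"
    unfolding power_mult_distrib Hnorm_squared by (simp add: dscale_def sob_nsq_cmult distrib_left)
  then show ?thesis
    by (rule power2_eq_imp_eq) (simp_all add: Hnorm_nonneg)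
qed

lemma Hsp_dscale: "x \<in> Hsp s l \<Longrightarrow> dscale a x \<in> Hsp s l"
  by (auto simp: Hsp_def dscale_def real_fc_def intro: in_sob_cmult)

lemma Hsp_dadd:
  assumes "x \<in> Hsp s l" and "y \<in> Hsp s l"
  shows "dadd x y \<in> Hsp s l" and "(Hnorm s l (dadd x y))\<^sup>2 \<le> 2 * (Hnorm s l x)\<^sup>2 + 2 * (Hnorm s l y)\<^sup>2"
proof -
  obtain a b c a' b' c' where [simp]: "x = (a, b, c)" "y = (a', b', c')"
    by (metis prod.exhaust)
  show "dadd x y \<in> Hsp s l"
    using assms by (auto simp: Hsp_def dadd_def real_fc_def intro: sob_add)
  have "sob_nsq s (\<lambda>k. a k + a' k) \<le> 2 * sob_nsq s a + 2 * sob_nsq s a'"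
    "sob_nsq l (\<lambda>k. b k + b' k) \<le> 2 * sob_nsq l b + 2 * sob_nsq l b'"
    "sob_nsq (l - 1) (\<lambda>k. c k + c' k) \<le> 2 * sob_nsq (l - 1) c + 2 * sob_nsq (l - 1) c'"
    using assms by (auto simp: Hsp_def intro!: sob_add)
  then show "(Hnorm s l (dadd x y))\<^sup>2 \<le> 2 * (Hnorm s l x)\<^sup>2 + 2 * (Hnorm s l y)\<^sup>2"
    unfolding Hnorm_squared by (simp add: dadd_def)
qed

lemma Hsp_dsub:
  assumes "x \<in> Hsp s l" and "y \<in> Hsp s l"
  shows "dsub x y \<in> Hsp s l" and "(Hnorm s l (dsub x y))\<^sup>2 \<le> 2 * (Hnorm s l x)\<^sup>2 + 2 * (Hnorm s l y)\<^sup>2"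
  unfolding dsub_def using Hsp_dadd[OF assms(1) Hsp_dscale[OF assms(2), of "-1"]]
  by (simp_all add: Hnorm_dscale)

lemma dadd_dsub_cancel: "dadd (dsub x y) y = x"
  by (cases x) (simp add: dadd_def dsub_def dscale_def)

text \<open>\<open>CTnorm\<close> is a supremum of reals, so it bounds \<open>Hnorm\<close> only along bounded trajectories.\<close>
definition bdd_traj :: "real \<Rightarrow> real \<Rightarrow> real \<Rightarrow> ('d::finite) traj \<Rightarrow> bool" where
  "bdd_traj T s l U \<longleftrightarrow> (\<forall>t\<in>{0..T}. U t \<in> Hsp s l) \<and> (\<exists>M. \<forall>t\<in>{0..T}. (Hnorm s l (U t))\<^sup>2 \<le> M)"

text \<open>Continuity bounds the norm near each time, and bisection glues the local bounds over the
  compact interval.\<close>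

lemma CT_imp_bdd_traj:
  assumes "U \<in> CT T s l" and "0 \<le> T"
  shows "bdd_traj T s l U"
proof -
  have H: "\<And>t. t \<in> {0..T} \<Longrightarrow> U t \<in> Hsp s l"
    and C: "\<And>t \<epsilon>. t \<in> {0..T} \<Longrightarrow> 0 < \<epsilon> \<Longrightarrow>
      \<exists>\<delta>>0. \<forall>t'\<in>{0..T}. \<bar>t' - t\<bar> < \<delta> \<longrightarrow> Hnorm s l (dsub (U t') (U t)) < \<epsilon>"
    using assms(1) by (auto simp: CT_def)
  \<comment> \<open>The guards are needed because the small intervals in the bisection argument may
    stick out of \<open>{0..T}\<close>.\<close>
  let ?P = "\<lambda>a b. 0 \<le> a \<longrightarrow> b \<le> T \<longrightarrow> (\<exists>M. \<forall>t\<in>{a..b}. (Hnorm s l (U t))\<^sup>2 \<le> M)"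
  have "?P 0 T"
  proof (rule Bolzano[of 0 T ?P, OF assms(2)])
    fix a b c
    assume *: "?P a b" "?P b c" "a \<le> b" "b \<le> c"
    show "?P a c"
    proof (intro impI)
      assume "0 \<le> a" "c \<le> T"
      then obtain M1 M2 where "\<forall>t\<in>{a..b}. (Hnorm s l (U t))\<^sup>2 \<le> M1" "\<forall>t\<in>{b..c}. (Hnorm s l (U t))\<^sup>2 \<le> M2"
        using * by force
      then have "\<forall>t\<in>{a..c}. (Hnorm s l (U t))\<^sup>2 \<le> max M1 M2"
        by (metis atLeastAtMost_iff le_max_iff_disj linear)
      then show "\<exists>M. \<forall>t\<in>{a..c}. (Hnorm s l (U t))\<^sup>2 \<le> M" by blast
    qed
  next
    fix x assume x: "0 \<le> x" "x \<le> T"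
    obtain \<delta> where \<delta>: "0 < \<delta>" "\<And>t. t \<in> {0..T} \<Longrightarrow> \<bar>t - x\<bar> < \<delta> \<Longrightarrow> Hnorm s l (dsub (U t) (U x)) < 1"
      using C[of x 1] x by auto
    have "(Hnorm s l (U t))\<^sup>2 \<le> 2 + 2 * (Hnorm s l (U x))\<^sup>2" if t: "t \<in> {0..T}" "\<bar>t - x\<bar> < \<delta>" for t
    proof -
      have "(Hnorm s l (U t))\<^sup>2 \<le> 2 * (Hnorm s l (dsub (U t) (U x)))\<^sup>2 + 2 * (Hnorm s l (U x))\<^sup>2"
        using Hsp_dadd(2)[OF Hsp_dsub(1)[OF H[OF t(1)] H[of x]] H[of x]] x by (simp add: dadd_dsub_cancel)
      moreover have "(Hnorm s l (dsub (U t) (U x)))\<^sup>2 \<le> 1"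
        using \<delta>(2)[OF t] by (intro power_le_one) (auto simp: Hnorm_nonneg)
      ultimately show ?thesis by simp
    qed
    then show "\<exists>d>0. \<forall>a b. a \<le> x \<and> x \<le> b \<and> b - a < d \<longrightarrow> ?P a b"
      using \<open>0 < \<delta>\<close> by (intro exI[of _ \<delta>] conjI allI impI exI[of _ "2 + 2 * (Hnorm s l (U x))\<^sup>2"] ballI) auto
  qed
  then have "\<exists>M. \<forall>t\<in>{0..T}. (Hnorm s l (U t))\<^sup>2 \<le> M"
    by simp
  with H show ?thesis by (simp add: bdd_traj_def)
qed

lemma bdd_traj_dsub:
  assumes "bdd_traj T s l U" and "bdd_traj T s l V"
  shows "bdd_traj T s l (\<lambda>t. dsub (U t) (V t))"
proof -
  obtain M1 M2 where "\<forall>t\<in>{0..T}. (Hnorm s l (U t))\<^sup>2 \<le> M1" "\<forall>t\<in>{0..T}. (Hnorm s l (V t))\<^sup>2 \<le> M2"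
    using assms by (auto simp: bdd_traj_def)
  then have "\<forall>t\<in>{0..T}. (Hnorm s l (dsub (U t) (V t)))\<^sup>2 \<le> 2 * M1 + 2 * M2"
    using assms Hsp_dsub(2) unfolding bdd_traj_def by (smt (verit))
  then show ?thesis
    using assms Hsp_dsub(1) unfolding bdd_traj_def by blast
qed

lemma Hnorm_le_CTnorm:
  assumes "bdd_traj T s l U" and "t \<in> {0..T}"
  shows "Hnorm s l (U t) \<le> CTnorm T s l U"
proof -
  obtain M where M: "\<And>t. t \<in> {0..T} \<Longrightarrow> (Hnorm s l (U t))\<^sup>2 \<le> M"
    using assms(1) unfolding bdd_traj_def by blast
  show ?thesis
    unfolding CTnorm_def
  proof (rule cSUP_upper[OF assms(2)], rule bdd_aboveI2)
    show "Hnorm s l (U t) \<le> sqrt M" if "t \<in> {0..T}" for t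
      using M[OF that] by (rule real_le_rsqrt)
  qed
qed

section \<open>Second derivatives tested on single coefficients of the velocity\<close>

definition vel :: "int ^ ('d::finite) \<Rightarrow> 'd dat \<Rightarrow> complex" where
  "vel k x = snd (snd x) k"

lemma vel_dsub: "vel k (dsub x y) = vel k x - vel k y"
  by (simp add: vel_def dsub_def dadd_def dscale_def)

lemma vel_bound:
  assumes "x \<in> Hsp s l"
  shows "cmod (vel k x) \<le> (1 + ksq k) powr ((1 - l) / 2) * Hnorm s l x"
proof -
  let ?m = "snd (snd x)" and ?w = "1 + ksq k"
  have w: "0 < ?w" using ksq_nonneg[of k] by simp
  have "?w powr (l - 1) * (cmod (?m k))\<^sup>2 \<le> sob_nsq (l - 1) ?m"
    using assms by (intro sob_nsq_coeff) (auto simp: Hsp_def)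
  also have "\<dots> \<le> (Hnorm s l x)\<^sup>2"
    unfolding Hnorm_squared by (simp add: sob_nsq_nonneg)
  finally have le: "?w powr (1 - l) * (?w powr (l - 1) * (cmod (?m k))\<^sup>2) \<le> ?w powr (1 - l) * (Hnorm s l x)\<^sup>2"
    by (intro mult_left_mono) auto
  have e1: "?w powr (1 - l) * (?w powr (l - 1) * (cmod (?m k))\<^sup>2) = (cmod (?m k))\<^sup>2"
    using w by (simp flip: powr_add mult.assoc)
  have e2: "?w powr (1 - l) = (?w powr ((1 - l) / 2))\<^sup>2"
    using w by (simp add: power2_eq_square flip: powr_add)
  have "(cmod (?m k))\<^sup>2 \<le> (?w powr ((1 - l) / 2) * Hnorm s l x)\<^sup>2"
    using le[unfolded e1, unfolded e2] by (simp only: power_mult_distrib)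
  then show ?thesis
    unfolding vel_def by (rule power2_le_imp_le) (simp add: Hnorm_nonneg)
qed

lemma vel_CTnorm:
  assumes "bdd_traj T s l U" and "t \<in> {0..T}"
  shows "cmod (vel k (U t)) \<le> (1 + ksq k) powr ((1 - l) / 2) * CTnorm T s l U"
proof -
  have "cmod (vel k (U t)) \<le> (1 + ksq k) powr ((1 - l) / 2) * Hnorm s l (U t)"
    using assms by (intro vel_bound) (auto simp: bdd_traj_def)
  also have "\<dots> \<le> (1 + ksq k) powr ((1 - l) / 2) * CTnorm T s l U"
    by (intro mult_left_mono Hnorm_le_CTnorm assms) auto
  finally show ?thesis .
qed

lemma bdd_lin_vel_scale:
  assumes "bdd_lin T s l L" and "x \<in> Hsp s l" and "t \<in> {0..T}"
  shows "vel k (L (dscale a x) t) = of_real a * vel k (L x t)"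
proof -
  have "dscale a x = dadd (dscale a x) (dscale 0 x)"
    by (simp add: dadd_def dscale_def)
  then have "L (dscale a x) t = dadd (dscale a (L x t)) (dscale 0 (L x t))"
    using assms unfolding bdd_lin_def by metis
  then show ?thesis
    by (simp add: vel_def dadd_def dscale_def)
qed

text \<open>\<open>F\<close> has second derivative \<open>b\<close> at 0, while its expansion on
  positive \<open>x\<close> starts with \<open>a * x\<^sup>2\<close>. The expansion forces
  \<open>F 0\<close> and \<open>F' 0\<close> to vanish; the mean value inequality then compares both
  quadratic terms.\<close>

lemma second_order_coefficient:
  fixes F F' :: "real \<Rightarrow> complex"
  assumes "0 < r"
    and der: "\<And>x. \<bar>x\<bar> < r \<Longrightarrow> (F has_vector_derivative F' x) (at x)"
    and der2: "\<And>\<eta>. 0 < \<eta> \<Longrightarrow> \<exists>\<delta>>0. \<forall>x. \<bar>x\<bar> < \<delta> \<longrightarrow> cmod (F' x - F' 0 - of_real x * b) \<le> \<eta> * \<bar>x\<bar>"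
    and expansion: "0 < x0" "\<And>x. 0 < x \<Longrightarrow> x \<le> x0 \<Longrightarrow> cmod (F x - of_real (x\<^sup>2) * a) \<le> C * x ^ 4"
  shows "b = 2 * a"
proof -
  have Fb: "cmod (F x) \<le> x\<^sup>2 * cmod a + C * x ^ 4" if "0 < x" "x \<le> x0" for x
  proof -
    have "cmod (F x) \<le> cmod (of_real (x\<^sup>2) * a) + cmod (F x - of_real (x\<^sup>2) * a)"
      by (rule norm_triangle_sub)
    then show ?thesis
      using expansion(2)[OF that] by (simp add: norm_mult norm_power)
  qed
  have ev: "\<forall>\<^sub>F x in at_right 0. 0 < x \<and> x \<le> x0"
    using expansion(1) by (auto simp: eventually_at_right_field intro!: exI[of _ x0])
  have F0: "F 0 = 0"
  proof (rule tendsto_unique[of "at_right 0"])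
    have "isCont F 0"
      using der[of 0] \<open>0 < r\<close> by (intro has_vector_derivative_continuous) auto
    then show "(F \<longlongrightarrow> F 0) (at_right 0)"
      unfolding continuous_at by (rule filterlim_mono[OF _ order_refl at_le]) auto
    show "(F \<longlongrightarrow> 0) (at_right 0)"
    proof (rule Lim_null_comparison)
      show "\<forall>\<^sub>F x in at_right 0. cmod (F x) \<le> x\<^sup>2 * cmod a + C * x ^ 4"
        using ev by eventually_elim (simp add: Fb)
      show "((\<lambda>x. x\<^sup>2 * cmod a + C * x ^ 4) \<longlongrightarrow> 0) (at_right 0)"
        by (rule tendsto_eq_intros refl | simp)+
    qed
  qed simp
  have F'0: "F' 0 = 0"
  proof (rule tendsto_unique[of "at_right 0"])
    have "(F has_vector_derivative F' 0) (at_right 0)"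
      using \<open>0 < r\<close> by (intro has_vector_derivative_at_within[OF der]) simp
    then have "((\<lambda>x. (F x - x *\<^sub>R F' 0) /\<^sub>R norm x) \<longlongrightarrow> 0) (at_right 0)"
      by (simp add: has_vector_derivative_def has_derivative_at_within F0)
    then have "((\<lambda>x. F x /\<^sub>R x - F' 0) \<longlongrightarrow> 0) (at_right 0)"
      by (rule Lim_transform_eventually)
         (use eventually_at_right_less[of "0 :: real"] in eventually_elim, simp add: scaleR_diff_right)
    then show "((\<lambda>x. F x /\<^sub>R x) \<longlongrightarrow> F' 0) (at_right 0)"
      by (rule LIM_zero_cancel)
    show "((\<lambda>x. F x /\<^sub>R x) \<longlongrightarrow> 0) (at_right 0)"
    proof (rule Lim_null_comparison)
      show "\<forall>\<^sub>F x in at_right 0. cmod (F x /\<^sub>R x) \<le> x * cmod a + C * x ^ 3"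
        using ev
      proof eventually_elim
        case (elim x)
        then have "cmod (F x) \<le> x * (x * cmod a + C * x ^ 3)"
          using Fb[of x] by (simp add: power2_eq_square power3_eq_cube power4_eq_xxxx algebra_simps)
        then show ?case
          using elim by (simp add: field_simps)
      qed
      show "((\<lambda>x. x * cmod a + C * x ^ 3) \<longlongrightarrow> 0) (at_right 0)"
        by (rule tendsto_eq_intros refl | simp)+
    qed
  qed simp
  have "cmod (a - b / 2) \<le> \<eta>" if \<eta>: "0 < \<eta>" for \<eta>
  proof -
    obtain \<delta> where \<delta>: "0 < \<delta>" "\<And>x. \<bar>x\<bar> < \<delta> \<Longrightarrow> cmod (F' x - of_real x * b) \<le> \<eta> * \<bar>x\<bar>"
      using der2[OF \<eta>] F'0 by auto
    have key: "cmod (a - b / 2) \<le> \<eta> + C * x\<^sup>2" if x: "0 < x" "x \<le> x0" "x < min \<delta> r" for x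
    proof -
      \<comment> \<open>Subtracting the Taylor polynomial predicted by \<open>b\<close> leaves a
        derivative of size at most \<open>\<eta> * x\<close> on \<open>{0..x}\<close>, hence an
        increment of at most \<open>\<eta> * x\<^sup>2\<close>.\<close>
      let ?G = "\<lambda>y. F y - of_real (y\<^sup>2) * (b / 2)"
      have "cmod (?G x - ?G 0) \<le> \<eta> * x * norm (x - 0)"
      proof (rule differentiable_bound[of "{0..x}" ?G "\<lambda>y h. h *\<^sub>R (F' y - of_real y * b)"])
        show "(?G has_derivative (\<lambda>h. h *\<^sub>R (F' y - of_real y * b))) (at y within {0..x})" if "y \<in> {0..x}" for y
        proof -
          have "(F has_vector_derivative F' y) (at y within {0..x})"
            using that x by (intro has_vector_derivative_at_within[OF der]) auto
          moreover have "((\<lambda>y. of_real (y\<^sup>2) * (b / 2)) has_vector_derivative of_real y * b) (at y within {0..x})"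
            by (rule has_vector_derivative_eq_rhs[OF has_vector_derivative_mult_left[OF has_vector_derivative_of_real]])
               (auto intro!: derivative_eq_intros)
          ultimately show ?thesis
            using has_vector_derivative_diff unfolding has_vector_derivative_def[symmetric] by blast
        qed
        show "onorm (\<lambda>h. h *\<^sub>R (F' y - of_real y * b)) \<le> \<eta> * x" if "y \<in> {0..x}" for y
        proof (rule onorm_le)
          fix h :: real
          have "cmod (F' y - of_real y * b) \<le> \<eta> * \<bar>y\<bar>"
            using that x by (intro \<delta>) auto
          also have "\<dots> \<le> \<eta> * x"
            using that \<eta> by (intro mult_left_mono) auto
          finally show "norm (h *\<^sub>R (F' y - of_real y * b)) \<le> \<eta> * x * norm h"
            by (simp add: mult.commute mult_left_mono)
        qed
      qed (use x in auto)
      then have "cmod (F x - of_real (x\<^sup>2) * (b / 2)) \<le> \<eta> * x\<^sup>2"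
        using x F0 by (simp add: power2_eq_square mult_ac)
      moreover have "cmod (of_real (x\<^sup>2) * (a - b / 2)) \<le>
          cmod (F x - of_real (x\<^sup>2) * (b / 2)) + cmod (F x - of_real (x\<^sup>2) * a)"
        using norm_triangle_ineq4[of "F x - of_real (x\<^sup>2) * (b / 2)" "F x - of_real (x\<^sup>2) * a"]
        by (simp add: right_diff_distrib)
      ultimately have "x\<^sup>2 * cmod (a - b / 2) \<le> \<eta> * x\<^sup>2 + C * x ^ 4"
        using expansion(2)[OF x(1,2)] by (simp add: norm_mult norm_power)
      also have "\<dots> = x\<^sup>2 * (\<eta> + C * x\<^sup>2)"
        by (simp add: power2_eq_square power4_eq_xxxx algebra_simps)
      finally show ?thesis
        using x by simp
    qed
    show ?thesis
    proof (rule tendsto_lowerbound[of "\<lambda>x. \<eta> + C * x\<^sup>2" _ "at_right 0"])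
      show "((\<lambda>x. \<eta> + C * x\<^sup>2) \<longlongrightarrow> \<eta>) (at_right 0)"
        by (rule tendsto_eq_intros refl | simp)+
      have "\<forall>\<^sub>F x in at_right 0. 0 < x \<and> x < min \<delta> r"
        using \<delta>(1) \<open>0 < r\<close> by (auto simp: eventually_at_right_field intro!: exI[of _ "min \<delta> r"])
      with ev show "\<forall>\<^sub>F x in at_right 0. cmod (a - b / 2) \<le> \<eta> + C * x\<^sup>2"
      proof eventually_elim
        case (elim x)
        then show ?case by (intro key) simp_all
      qed
    qed simp
  qed
  then have "cmod (a - b / 2) \<le> 0"
    by (rule dense_ge)
  then show ?thesis by auto
qed

text \<open>Restriction to the line spanned by \<open>\<phi>\<close> and to one coefficient at one
  time reduces the Frechet conditions to a scalar function of a real variable.\<close>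

proposition twice_frechet_coefficient:
  fixes S :: "('d::finite) dat \<Rightarrow> 'd traj"
  assumes "0 < T" and S: "\<And>\<phi>. \<phi> \<in> uball s l \<Longrightarrow> S \<phi> \<in> CT T s l"
    and "twice_frechet_at0 T s l S"
  shows "\<exists>B. bdd_bilin T s l B \<and>
    (\<forall>\<phi>\<in>Hsp s l. \<forall>t\<in>{0..T}. \<forall>k a C. \<forall>x0>0.
      (\<forall>x. 0 < x \<longrightarrow> x \<le> x0 \<longrightarrow> cmod (vel k (S (dscale x \<phi>) t) - of_real (x\<^sup>2) * a) \<le> C * x ^ 4) \<longrightarrow>
      vel k (B \<phi> \<phi> t) = 2 * a)"
proof -
  obtain r D B where r: "0 < r" "r \<le> 1"
    and D: "\<And>x. x \<in> Hsp s l \<Longrightarrow> Hnorm s l x < r \<Longrightarrow> frechet_at T s l S (D x) x"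
    and B: "bdd_bilin T s l B"
    and DB: "\<And>\<epsilon>. 0 < \<epsilon> \<Longrightarrow> \<exists>\<delta>>0. \<forall>x\<in>Hsp s l. Hnorm s l x < \<delta> \<longrightarrow>
           (\<forall>h\<in>Hsp s l. CTnorm T s l (\<lambda>t. dsub (dsub (D x h t) (D dzero h t)) (B x h t))
                            \<le> \<epsilon> * Hnorm s l x * Hnorm s l h)"
    using assms(3) unfolding twice_frechet_at0_def by blast
  have bt: "bdd_traj T s l U" if "U \<in> CT T s l" for U :: "'d traj"
    using CT_imp_bdd_traj[OF that] assms(1) by simp
  have linbt: "bdd_traj T s l (L x)" if "bdd_lin T s l L" "x \<in> Hsp s l" for L :: "'d dat \<Rightarrow> 'd traj" and x
    using that by (intro bt) (auto simp: bdd_lin_def)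
  have "vel k (B \<phi> \<phi> t) = 2 * a"
    if \<phi>: "\<phi> \<in> Hsp s l" and t: "t \<in> {0..T}" and x0: "0 < x0"
      and ex: "\<And>x. 0 < x \<Longrightarrow> x \<le> x0 \<Longrightarrow> cmod (vel k (S (dscale x \<phi>) t) - of_real (x\<^sup>2) * a) \<le> C * x ^ 4"
    for \<phi> t k a C x0
  proof -
    \<comment> \<open>Adding 1 keeps \<open>N\<close> positive even for \<open>\<phi>\<close> of
      norm zero; below, \<open>c\<close> is the bound of the coefficient functional.\<close>
    define N where "N = Hnorm s l \<phi> + 1"
    have N: "0 < N" "Hnorm s l \<phi> \<le> N"
      using Hnorm_nonneg[of s l \<phi>] by (auto simp: N_def)
    define c where "c = (1 + ksq k) powr ((1 - l) / 2)"
    have c: "0 < c"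
      using ksq_nonneg[of k] by (simp add: c_def)
    have small: "Hnorm s l (dscale x \<phi>) < q" if "\<bar>x\<bar> < q / N" for x q
    proof -
      have "\<bar>x\<bar> * Hnorm s l \<phi> \<le> \<bar>x\<bar> * N"
        using N by (intro mult_left_mono) auto
      also have "\<dots> < q"
        using that N by (simp add: pos_less_divide_eq)
      finally show ?thesis by (simp add: Hnorm_dscale)
    qed
    have ball: "dscale x \<phi> \<in> uball s l" if "\<bar>x\<bar> < 1 / N" for x
      using small[OF that] \<phi> by (simp add: uball_def Hsp_dscale)
    have rN: "r / N \<le> 1 / N"
      using r N by (simp add: divide_right_mono)
    have fr: "frechet_at T s l S (D (dscale x \<phi>)) (dscale x \<phi>)" if "\<bar>x\<bar> < r / N" for x
      using small[OF that] by (intro D Hsp_dscale \<phi>)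
    define F where "F x = vel k (S (dscale x \<phi>) t)" for x
    define F' where "F' x = vel k (D (dscale x \<phi>) \<phi> t)" for x
    show ?thesis
    proof (rule second_order_coefficient[of "r / N" F F' _ x0 a C])
      show "0 < r / N" using r N by simp
      show "(F has_vector_derivative F' x) (at x)" if x: "\<bar>x\<bar> < r / N" for x
        unfolding has_vector_derivative_def has_derivative_at_alt
      proof (intro conjI bounded_linear_scaleR_left allI impI)
        fix e :: real assume "0 < e"
        let ?x = "dscale x \<phi>"
        have lin: "bdd_lin T s l (D ?x)"
          using fr[OF x] by (simp add: frechet_at_def)
        obtain \<delta> where \<delta>: "0 < \<delta>" "\<And>y. y \<in> uball s l \<Longrightarrow> Hnorm s l (dsub y ?x) < \<delta> \<Longrightarrow>
            CTnorm T s l (\<lambda>t. dsub (dsub (S y t) (S ?x t)) (D ?x (dsub y ?x) t)) \<le> e / (c * N) * Hnorm s l (dsub y ?x)"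
        proof -
          have "0 < e / (c * N)"
            using \<open>0 < e\<close> c N by simp
          with fr[OF x] that show thesis
            unfolding frechet_at_def by blast
        qed
        define d where "d = min (\<delta> / N) (r / N - \<bar>x\<bar>)"
        have "cmod (F y - F x - (y - x) *\<^sub>R F' x) \<le> e * norm (y - x)" if y: "norm (y - x) < d" for y
        proof -
          let ?y = "dscale y \<phi>"
          have yr: "\<bar>y\<bar> < 1 / N"
            using y rN by (auto simp: d_def)
          have xr: "\<bar>x\<bar> < 1 / N"
            using x rN by simp
          have yx: "dsub ?y ?x = dscale (y - x) \<phi>"
            by (simp add: dsub_def dadd_def dscale_def algebra_simps)
          have h: "Hnorm s l (dsub ?y ?x) < \<delta>"
            unfolding yx using y by (intro small) (simp add: d_def)
          let ?W = "\<lambda>t. dsub (dsub (S ?y t) (S ?x t)) (D ?x (dscale (y - x) \<phi>) t)"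
          \<comment> \<open>Without boundedness the supremum in \<open>CTnorm\<close> would carry no
            information about the value at \<open>t\<close>.\<close>
          have "bdd_traj T s l ?W"
            by (intro bdd_traj_dsub linbt lin Hsp_dscale \<phi> bt S ball xr yr)
          from vel_CTnorm[OF this t, of k]
          have "cmod (vel k (?W t)) \<le> c * CTnorm T s l ?W"
            by (simp add: c_def)
          also have "\<dots> \<le> c * (e / (c * N) * (\<bar>y - x\<bar> * Hnorm s l \<phi>))"
            using \<delta>(2)[OF ball[OF yr] h] c by (intro mult_left_mono) (auto simp: yx Hnorm_dscale)
          also have "\<dots> \<le> c * (e / (c * N) * (\<bar>y - x\<bar> * N))"
            using c N \<open>0 < e\<close> by (intro mult_left_mono) auto
          also have "\<dots> = e * norm (y - x)"
            using c N by simp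
          also have "vel k (?W t) = F y - F x - (y - x) *\<^sub>R F' x"
            unfolding vel_dsub bdd_lin_vel_scale[OF lin \<phi> t] F_def F'_def by (simp add: scaleR_conv_of_real)
          finally show ?thesis .
        qed
        moreover have "0 < d"
          using \<delta>(1) N x by (simp add: d_def)
        ultimately show "\<exists>d>0. \<forall>y. norm (y - x) < d \<longrightarrow> norm (F y - F x - (y - x) *\<^sub>R F' x) \<le> e * norm (y - x)"
          by blast
      qed
      show "\<exists>\<delta>>0. \<forall>x. \<bar>x\<bar> < \<delta> \<longrightarrow> cmod (F' x - F' 0 - of_real x * vel k (B \<phi> \<phi> t)) \<le> \<eta> * \<bar>x\<bar>"
        if \<eta>: "0 < \<eta>" for \<eta>
      proof -
        have "0 < \<eta> / (c * N * N)"
          using \<eta> c N by simp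
        from DB[OF this] obtain \<delta> where \<delta>: "0 < \<delta>"
          "\<And>x h. x \<in> Hsp s l \<Longrightarrow> Hnorm s l x < \<delta> \<Longrightarrow> h \<in> Hsp s l \<Longrightarrow>
             CTnorm T s l (\<lambda>t. dsub (dsub (D x h t) (D dzero h t)) (B x h t)) \<le> \<eta> / (c * N * N) * Hnorm s l x * Hnorm s l h"
          by blast
        define d where "d = min (\<delta> / N) (r / N)"
        have "cmod (F' x - F' 0 - of_real x * vel k (B \<phi> \<phi> t)) \<le> \<eta> * \<bar>x\<bar>" if x: "\<bar>x\<bar> < d" for x
        proof -
          let ?x = "dscale x \<phi>"
          have z: "dzero = dscale 0 \<phi>"
            by (simp add: dzero_def dscale_def)
          have "bdd_lin T s l (D ?x)" "bdd_lin T s l (D dzero)"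
            using fr[of x] fr[of 0] x r N by (auto simp: frechet_at_def d_def z)
          moreover have "bdd_lin T s l (B ?x)" and Bl: "bdd_lin T s l (\<lambda>x. B x \<phi>)"
            using B Hsp_dscale[OF \<phi>] \<phi> by (auto simp: bdd_bilin_def)
          ultimately have "bdd_traj T s l (\<lambda>t. dsub (dsub (D ?x \<phi> t) (D dzero \<phi> t)) (B ?x \<phi> t))"
            (is "bdd_traj T s l ?W")
            by (intro bdd_traj_dsub linbt \<phi>)
          from vel_CTnorm[OF this t, of k]
          have "cmod (vel k (?W t)) \<le> c * CTnorm T s l ?W"
            by (simp add: c_def)
          also have "\<dots> \<le> c * (\<eta> / (c * N * N) * (\<bar>x\<bar> * Hnorm s l \<phi>) * Hnorm s l \<phi>)"
            using \<delta>(2)[OF Hsp_dscale[OF \<phi>] small \<phi>, of x] x c by (intro mult_left_mono) (auto simp: d_def Hnorm_dscale)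
          also have "\<dots> \<le> c * (\<eta> / (c * N * N) * (\<bar>x\<bar> * N) * N)"
            using c N \<eta> Hnorm_nonneg[of s l \<phi>] by (intro mult_left_mono mult_mono) auto
          also have "\<dots> = \<eta> * \<bar>x\<bar>"
            using c N by simp
          also have "vel k (?W t) = F' x - F' 0 - of_real x * vel k (B \<phi> \<phi> t)"
            unfolding vel_dsub bdd_lin_vel_scale[OF Bl \<phi> t] F'_def z ..
          finally show ?thesis .
        qed
        moreover have "0 < d"
          using \<delta>(1) N r by (simp add: d_def)
        ultimately show ?thesis by blast
      qed
      show "0 < x0" by (rule x0)
      show "cmod (F x - of_real (x\<^sup>2) * a) \<le> C * x ^ 4" if "0 < x" "x \<le> x0" for x
        using ex[OF that] by (simp add: F_def)
    qed
  qed
  with B show ?thesis by blast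
qed

section \<open>Concentrated data\<close>

lemma in_sob_finite_support:
  assumes "finite {k. f k \<noteq> 0}" shows "in_sob \<sigma> f"
  unfolding in_sob_def using assms
  by (intro finite_nonzero_values_imp_summable_on) (auto elim: rev_finite_subset)

lemma in_sob_zero: "in_sob \<sigma> (\<lambda>k. 0)"
  by (rule in_sob_finite_support) simp

lemma Hsp_finite_support: "finite {k. u0 k \<noteq> 0} \<Longrightarrow> (u0, \<lambda>k. 0, \<lambda>k. 0) \<in> Hsp s l"
  by (simp add: Hsp_def real_fc_def in_sob_finite_support in_sob_zero)

text \<open>Small multiples of a trigonometric polynomial are smooth data in the unit ball, so
  \<open>S\<close> must agree there with the constructed classical solutions, whose quadratic
  coefficient is explicit.\<close>

lemma second_derivative_velocity:
  fixes S :: "('d::finite) dat \<Rightarrow> 'd traj" and u0 :: "'d fc"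
  assumes "0 < T" and S: "data_to_sol T s l S" and fin: "finite {k. u0 k \<noteq> 0}"
    and t: "t \<in> {0..T}"
    and B: "\<forall>\<phi>\<in>Hsp s l. \<forall>t\<in>{0..T}. \<forall>k a C. \<forall>x0>0.
      (\<forall>x. 0 < x \<longrightarrow> x \<le> x0 \<longrightarrow> cmod (vel k (S (dscale x \<phi>) t) - of_real (x\<^sup>2) * a) \<le> C * x ^ 4) \<longrightarrow>
      vel k (B \<phi> \<phi> t) = 2 * a"
  shows "vel k (B (u0, \<lambda>k. 0, \<lambda>k. 0) (u0, \<lambda>k. 0, \<lambda>k. 0) t)
     = 2 * wave_deriv (conv (free_evolution u0) (flip (free_evolution u0))) t k"
proof -
  define \<phi> :: "'d dat" where "\<phi> = (u0, \<lambda>k. 0, \<lambda>k. 0)"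
  have H: "\<phi> \<in> Hsp s l"
    unfolding \<phi>_def by (rule Hsp_finite_support[OF fin])
  have "(\<lambda>k. cmod (u0 k) * exp ((1 + T) * freq k)) summable_on UNIV"
    using fin by (intro finite_nonzero_values_imp_summable_on) (auto elim: rev_finite_subset)
  from small_classical_solutions[OF assms(1) this] obtain \<epsilon>0 C where "0 < \<epsilon>0" and
    sol: "\<And>\<epsilon>. 0 < \<epsilon> \<Longrightarrow> \<epsilon> \<le> \<epsilon>0 \<Longrightarrow> \<exists>U. classical_sol T (dscale \<epsilon> \<phi>) U \<and>
     (\<forall>t\<in>{0..T}. \<forall>k. cmod (snd (snd (U t)) k
        - of_real (\<epsilon>\<^sup>2) * wave_deriv (conv (free_evolution u0) (flip (free_evolution u0))) t k)
           \<le> ksq k * C * \<epsilon> ^ 4)"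
    unfolding \<phi>_def by blast
  \<comment> \<open>Division by the norm plus 1 places \<open>x\<close> times \<open>\<phi>\<close>
    strictly inside the unit ball.\<close>
  define x0 where "x0 = min \<epsilon>0 (1 / (Hnorm s l \<phi> + 1))"
  have n: "0 < Hnorm s l \<phi> + 1"
    using Hnorm_nonneg[of s l \<phi>] by simp
  show ?thesis
    unfolding \<phi>_def[symmetric]
  proof (rule B[rule_format, OF H t])
    show "0 < x0"
      using \<open>0 < \<epsilon>0\<close> n by (simp add: x0_def)
    fix x assume x: "0 < x" "x \<le> x0"
    have "x * (Hnorm s l \<phi> + 1) \<le> 1"
      using x n by (simp add: x0_def pos_le_divide_eq)
    then have "dscale x \<phi> \<in> uball s l"
      using x H by (simp add: uball_def Hsp_dscale Hnorm_dscale distrib_left)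
    moreover have "smooth_dat (dscale x \<phi>)"
      using in_sob_cmult[OF in_sob_finite_support[OF fin]]
      by (simp add: smooth_dat_def \<phi>_def dscale_def in_sob_zero)
    moreover obtain U where U: "classical_sol T (dscale x \<phi>) U"
      "cmod (snd (snd (U t)) k - of_real (x\<^sup>2) * wave_deriv (conv (free_evolution u0) (flip (free_evolution u0))) t k)
           \<le> ksq k * C * x ^ 4"
      using sol[of x] x t by (auto simp: x0_def)
    ultimately have "S (dscale x \<phi>) t = U t"
      using S t unfolding data_to_sol_def by blast
    with U(2) show "cmod (vel k (S (dscale x \<phi>) t)
        - of_real (x\<^sup>2) * wave_deriv (conv (free_evolution u0) (flip (free_evolution u0))) t k) \<le> ksq k * C * x ^ 4"
      by (simp add: vel_def)
  qed
qed

section \<open>Lattice points in cubes\<close>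

definition lattice_box :: "nat \<Rightarrow> nat \<Rightarrow> (int ^ ('d::finite)) set" where
  "lattice_box a b = {k. \<forall>i. int a \<le> k $ i \<and> k $ i \<le> int b}"

lemma bij_betw_lattice_box: "bij_betw (\<lambda>f. \<chi> i. f i) (UNIV \<rightarrow>\<^sub>E {int a..int b}) (lattice_box a b :: (int ^ ('d::finite)) set)"
  by (rule bij_betw_byWitness[where f' = "\<lambda>k. ($) k"]) (auto simp: lattice_box_def PiE_def extensional_def vec_eq_iff)

lemma finite_lattice_box [simp]: "finite (lattice_box a b)"
  using bij_betw_finite[OF bij_betw_lattice_box] by (simp add: finite_PiE)

lemma card_lattice_box:
  assumes "a \<le> b"
  shows "card (lattice_box a b :: (int ^ ('d::finite)) set) = (b - a + 1) ^ CARD('d)"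
proof -
  have "card (lattice_box a b :: (int ^ 'd) set) = card ((UNIV :: 'd set) \<rightarrow>\<^sub>E {int a..int b})"
    using bij_betw_same_card[OF bij_betw_lattice_box] by metis
  also have "\<dots> = (b - a + 1) ^ CARD('d)"
  proof -
    have "nat (int b - int a + 1) = b - a + 1"
      using assms by linarith
    then show ?thesis by (simp add: card_PiE)
  qed
  finally show ?thesis .
qed

lemma ksq_lattice_box:
  assumes "(k :: int ^ ('d::finite)) \<in> lattice_box a b"
  shows "real CARD('d) * (real a)\<^sup>2 \<le> ksq k" and "ksq k \<le> real CARD('d) * (real b)\<^sup>2"
proof -
  have k: "real a \<le> real_of_int (k $ i)" "real_of_int (k $ i) \<le> real b" for i
    using assms by (auto simp: lattice_box_def) (metis of_int_le_iff of_int_of_nat_eq)+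
  have "(\<Sum>i\<in>(UNIV :: 'd set). (real a)\<^sup>2) \<le> ksq k" "ksq k \<le> (\<Sum>i\<in>(UNIV :: 'd set). (real b)\<^sup>2)"
    unfolding ksq_def by (intro sum_mono power_mono k; use k(1) order_trans[OF of_nat_0_le_iff k(1)] in simp)+
  then show "real CARD('d) * (real a)\<^sup>2 \<le> ksq k" "ksq k \<le> real CARD('d) * (real b)\<^sup>2"
    by simp_all
qed

section \<open>Lower bound for the velocity before phases turn\<close>

lemma Re_duh_lower:
  assumes "coeffs_continuous T g" and "0 \<le> t" "t \<le> T"
    and le: "\<And>s. 0 \<le> s \<Longrightarrow> s \<le> t \<Longrightarrow> c \<le> Re (cis (L k * (s - t)) * g s k)"
  shows "t * c \<le> Re (duh L g t k)"
proof -
  have i: "(\<lambda>s. cis (L k * s) * g s k) integrable_on {0..t}"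
    by (intro integrable_continuous_interval duh_integrand_continuous[OF assms(1,3)])
  have "((\<lambda>s. cis (- L k * t) * (cis (L k * s) * g s k)) has_integral duh L g t k) {0..t}"
    unfolding duh_def by (intro has_integral_mult_right integrable_integral i)
  then have "((\<lambda>s. Re (cis (- L k * t) * (cis (L k * s) * g s k))) has_integral Re (duh L g t k)) {0..t}"
    by (rule has_integral_Re)
  moreover have "((\<lambda>s. c) has_integral t * c) {0..t}"
    using has_integral_const_real[of c 0 t] assms(2) by simp
  ultimately have "((\<lambda>s. c) has_integral t * c) {0..t}"
    "((\<lambda>s. Re (cis (- L k * t) * (cis (L k * s) * g s k))) has_integral Re (duh L g t k)) {0..t}"
    by simp_all
  then show ?thesis
  proof (rule has_integral_le)
    show "c \<le> Re (cis (- L k * t) * (cis (L k * s) * g s k))" if "s \<in> {0..t}" for s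
    proof -
      \<comment> \<open>Inside the integral the two phases combine to one depending on
        \<open>s - t\<close>, which stays small for short times.\<close>
      have "cis (- L k * t) * (cis (L k * s) * g s k) = cis (L k * (s - t)) * g s k"
        by (simp add: cis_mult algebra_simps flip: mult.assoc)
      with that show ?thesis
        by (simp only: le atLeastAtMost_iff)
    qed
  qed
qed

lemma cos_ge_half:
  fixes x :: real
  assumes "\<bar>x\<bar> \<le> 1" shows "1 / 2 \<le> cos x"
proof -
  have "cos (pi / 3) \<le> cos \<bar>x\<bar>"
    using assms pi_gt3 by (intro cos_monotone_0_pi_le) auto
  then show ?thesis
    by (simp add: cos_60)
qed

text \<open>Up to time \<open>t\<close> the wave phase is at most
  \<open>4 * d * N\<^sup>2 * t\<close> and the Schroedinger phase at most
  \<open>16 * d * N\<^sup>2 * t\<close>; the total is at most 1, so every term has real part at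
  least 1/2 and both half waves add up.\<close>

lemma wave_deriv_lattice_box_lower:
  fixes k :: "int ^ ('d::finite)"
  defines "d \<equiv> real CARD('d)"
  assumes N: "0 < N" and k: "k \<in> lattice_box N (2 * N)" and t: "t = 1 / (20 * d * (real N)\<^sup>2)"
  defines "v \<equiv> free_evolution (indicator (lattice_box N (4 * N)))"
  shows "real N ^ CARD('d) / 40 \<le> cmod (wave_deriv (conv v (flip v)) t k)"
proof -
  define J where "J = {j \<in> lattice_box N (4 * N). j - k \<in> lattice_box N (4 * N)}"
  have J: "finite J"
    unfolding J_def by (rule finite_subset[OF _ finite_lattice_box]) auto
  have d: "1 \<le> d"
    by (simp add: d_def)
  have dN: "1 \<le> d * (real N)\<^sup>2"
    using d N by (intro mult_ge1_I) (auto simp: one_le_power)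
  have t0: "0 < t"
    using dN by (simp add: t)
  \<comment> \<open>Every \<open>j\<close> with entries between \<open>3 * N\<close> and
    \<open>4 * N\<close> contributes, since subtracting \<open>k\<close> leaves entries between
    \<open>N\<close> and \<open>3 * N\<close>.\<close>
  have "real N ^ CARD('d) \<le> real (card (lattice_box (3 * N) (4 * N) :: (int ^ 'd) set))"
    by (simp add: card_lattice_box power_mono)
  also have "\<dots> \<le> real (card J)"
  proof (intro of_nat_mono card_mono J subsetI)
    fix j :: "int ^ 'd" assume j: "j \<in> lattice_box (3 * N) (4 * N)"
    have "int N \<le> j $ i \<and> j $ i \<le> 4 * int N \<and> int N \<le> j $ i - k $ i \<and> j $ i - k $ i \<le> 4 * int N" for i
    proof -
      have "int N \<le> k $ i" "k $ i \<le> 2 * int N" "3 * int N \<le> j $ i" "j $ i \<le> 4 * int N"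
        using k j by (simp_all add: lattice_box_def)
      then show ?thesis by linarith
    qed
    then show "j \<in> J"
      by (simp add: J_def lattice_box_def)
  qed
  finally have NJ: "real N ^ CARD('d) \<le> real (card J)" .
  have conv: "conv v (flip v) s k = (\<Sum>j\<in>J. cis ((ksq (j - k) - ksq j) * s))" for s
  proof -
    have "conv v (flip v) s k = (\<Sum>\<^sub>\<infinity>j\<in>J. cis ((ksq (j - k) - ksq j) * s))"
      unfolding conv_def
    proof (rule infsum_cong_neutral)
      fix j assume "j \<in> UNIV \<inter> J"
      then have "v s j * flip v s (k - j) = cis (- ksq j * s) * cnj (cis (- ksq (j - k) * s))"
        by (simp add: v_def free_evolution_def flip_def J_def)
      then show "v s j * flip v s (k - j) = cis ((ksq (j - k) - ksq j) * s)"
        by (simp add: cis_cnj cis_mult algebra_simps)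
    qed (auto simp: v_def free_evolution_def flip_def J_def indicator_def)
    then show ?thesis using J by simp
  qed
  have cont: "coeffs_continuous t (conv v (flip v))"
  proof -
    have "(\<lambda>k. cmod (indicator (lattice_box N (4 * N)) k :: complex) * exp ((1 + t) * freq k)) summable_on UNIV"
      by (rule finite_nonzero_values_imp_summable_on, rule finite_subset[OF _ finite_lattice_box[of N "4 * N"]])
         (auto simp: indicator_def split: if_splits)
    from wbd_coeffs_continuous[OF wbd_intensity[OF wbd_free_evolution[OF this]]]
    show ?thesis unfolding v_def .
  qed
  have ksqk: "d * (real N)\<^sup>2 \<le> ksq k" "ksq k \<le> 4 * d * (real N)\<^sup>2"
    using ksq_lattice_box[OF k] by (auto simp: d_def power_mult_distrib)
  have freq: "freq k \<le> 4 * d * (real N)\<^sup>2"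
  proof -
    have "1 \<le> ksq k" using ksqk(1) dN by linarith
    then have "freq k \<le> ksq k"
      unfolding freq_def by (intro real_le_lsqrt self_le_power) auto
    with ksqk show ?thesis by linarith
  qed
  have duh: "t * (real N ^ CARD('d) / 2) \<le> Re (duh L (conv v (flip v)) t k)" if L: "\<bar>L k\<bar> = freq k" for L
  proof (rule Re_duh_lower[OF cont])
    fix s assume s: "0 \<le> s" "s \<le> t"
    have "1 / 2 \<le> cos (L k * (s - t) + (ksq (j - k) - ksq j) * s)" if "j \<in> J" for j
    proof (rule cos_ge_half)
      have "\<bar>ksq (j - k) - ksq j\<bar> \<le> 16 * d * (real N)\<^sup>2"
        using ksq_lattice_box(2)[of j N "4 * N"] ksq_lattice_box(2)[of "j - k" N "4 * N"] that ksq_nonneg[of j] ksq_nonneg[of "j - k"]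
        by (auto simp: J_def d_def power_mult_distrib)
      then have "\<bar>(ksq (j - k) - ksq j) * s\<bar> \<le> 16 * d * (real N)\<^sup>2 * t"
        unfolding abs_mult using s by (intro mult_mono) auto
      moreover have "\<bar>L k * (s - t)\<bar> \<le> 4 * d * (real N)\<^sup>2 * t"
        unfolding abs_mult L using s freq freq_nonneg[of k] by (intro mult_mono) auto
      moreover have "20 * d * (real N)\<^sup>2 * t = 1"
        using d N by (simp add: t)
      ultimately show "\<bar>L k * (s - t) + (ksq (j - k) - ksq j) * s\<bar> \<le> 1"
        by linarith
    qed
    then have le: "(\<Sum>j\<in>J. 1 / 2) \<le> (\<Sum>j\<in>J. cos (L k * (s - t) + (ksq (j - k) - ksq j) * s))"
      by (rule sum_mono)
    have "real N ^ CARD('d) / 2 \<le> (\<Sum>j\<in>J. 1 / 2)"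
      using NJ by simp
    also note le
    also have "(\<Sum>j\<in>J. cos (L k * (s - t) + (ksq (j - k) - ksq j) * s)) = Re (cis (L k * (s - t)) * conv v (flip v) s k)"
      by (simp add: conv sum_distrib_left cis_mult)
    finally show "real N ^ CARD('d) / 2 \<le> Re (cis (L k * (s - t)) * conv v (flip v) s k)" .
  qed (use t0 in auto)
  \<comment> \<open>The choice of \<open>t\<close> makes \<open>d * N\<^sup>2 / 2 * t\<close> equal
    to 1/40; the two halves of the bound, one per half wave, have been added.\<close>
  have "real N ^ CARD('d) / 40 = d * (real N)\<^sup>2 / 2 * (t * (real N ^ CARD('d)))"
    using d N by (simp add: t)
  also have "\<dots> \<le> ksq k / 2 * (t * (real N ^ CARD('d)))"
    using ksqk(1) t0 by (intro mult_right_mono) auto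
  also have "\<dots> \<le> ksq k / 2 * (Re (duh (\<lambda>k. - freq k) (conv v (flip v)) t k) + Re (duh freq (conv v (flip v)) t k))"
    using duh[of "\<lambda>k. - freq k"] duh[of freq] freq_nonneg[of k] ksq_nonneg[of k] by (intro mult_left_mono) auto
  also have "\<dots> = - Re (wave_deriv (conv v (flip v)) t k)"
    by (simp add: wave_deriv_def flip: of_real_minus)
  also have "\<dots> \<le> cmod (wave_deriv (conv v (flip v)) t k)"
    using abs_Re_le_cmod[of "wave_deriv (conv v (flip v)) t k"] by linarith
  finally show ?thesis .
qed

section \<open>Size of the Sobolev weights and of the concentrated data\<close>

lemma weight_lattice_box:
  fixes k :: "int ^ ('d::finite)" and p :: real
  defines "c \<equiv> 17 * real CARD('d)"
  assumes "0 < N" and "k \<in> lattice_box N (4 * N)"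
  shows "(1 + ksq k) powr p \<le> max 1 (c powr p) * real N powr (2 * p)"
    and "min 1 (c powr p) * real N powr (2 * p) \<le> (1 + ksq k) powr p"
proof -
  \<comment> \<open>After scaling by \<open>N\<^sup>2\<close> the weight lies between 1 and
    \<open>17 * d\<close>, from \<open>16 * d\<close> plus 1. The maximum and minimum with 1 cover
    both signs of the exponent \<open>p\<close>.\<close>
  define y where "y = (1 + ksq k) / (real N)\<^sup>2"
  have d: "1 \<le> real CARD('d)" by simp
  have N: "1 \<le> (real N)\<^sup>2"
    using assms(2) by (simp add: one_le_power)
  have "1 \<le> y" "y \<le> c"
  proof -
    have "1 * (real N)\<^sup>2 \<le> real CARD('d) * (real N)\<^sup>2"
      using d by (intro mult_right_mono) auto
    then have "(real N)\<^sup>2 \<le> 1 + ksq k" "1 + ksq k \<le> c * (real N)\<^sup>2"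
      using ksq_lattice_box[OF assms(3)] N by (auto simp: c_def power_mult_distrib)
    then show "1 \<le> y" "y \<le> c"
      using assms(2) by (auto simp: y_def pos_le_divide_eq pos_divide_le_eq)
  qed
  have "(1 + ksq k) powr p = ((real N)\<^sup>2 * y) powr p"
    using assms(2) by (simp add: y_def)
  also have "\<dots> = real N powr (2 * p) * y powr p"
    using \<open>1 \<le> y\<close> assms(2) by (simp add: powr_mult powr_powr flip: powr_numeral)
  finally have eq: "(1 + ksq k) powr p = y powr p * real N powr (2 * p)"
    by simp
  have "y powr p \<le> max 1 (c powr p) \<and> min 1 (c powr p) \<le> y powr p"
  proof (cases "0 \<le> p")
    case True
    then show ?thesis
      using \<open>1 \<le> y\<close> \<open>y \<le> c\<close> powr_mono2[of p y c] ge_one_powr_ge_zero[of y p] by auto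
  next
    case False
    then show ?thesis
      using \<open>1 \<le> y\<close> \<open>y \<le> c\<close> powr_mono2'[of p y c] powr_mono2'[of p 1 y] by auto
  qed
  then show "(1 + ksq k) powr p \<le> max 1 (c powr p) * real N powr (2 * p)"
    "min 1 (c powr p) * real N powr (2 * p) \<le> (1 + ksq k) powr p"
    unfolding eq by (auto intro!: mult_right_mono)
qed

lemma Hnorm_indicator_lattice_box:
  fixes s l :: real
  defines "K \<equiv> max 1 ((17 * real CARD('d::finite)) powr s)"
  assumes "0 < N"
  shows "(Hnorm s l (indicator (lattice_box N (4 * N)) :: 'd fc, \<lambda>k. 0, \<lambda>k. 0))\<^sup>2
     \<le> 4 ^ CARD('d) * K * real N powr (real CARD('d) + 2 * s)"
proof -
  let ?b = "lattice_box N (4 * N) :: (int ^ 'd) set"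
  have "(Hnorm s l (indicator ?b :: 'd fc, \<lambda>k. 0, \<lambda>k. 0))\<^sup>2 = (\<Sum>\<^sub>\<infinity>k\<in>?b. (1 + ksq k) powr s)"
  proof -
    have "sob_nsq s (indicator ?b) = (\<Sum>\<^sub>\<infinity>k\<in>?b. (1 + ksq k) powr s)"
      unfolding sob_nsq_def by (rule infsum_cong_neutral) (auto simp: indicator_def)
    moreover have "sob_nsq \<sigma> (\<lambda>k :: int ^ 'd. 0) = 0" for \<sigma>
      by (simp add: sob_nsq_def)
    ultimately show ?thesis
      by (simp add: Hnorm_squared)
  qed
  also have "\<dots> = (\<Sum>k\<in>?b. (1 + ksq k) powr s)"
    by simp
  also have "\<dots> \<le> (\<Sum>k\<in>?b. K * real N powr (2 * s))"
    unfolding K_def using assms(2) by (intro sum_mono weight_lattice_box)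
  also have "\<dots> = real (3 * N + 1) ^ CARD('d) * (K * real N powr (2 * s))"
    by (simp add: card_lattice_box)
  \<comment> \<open>A box side has \<open>3 * N + 1\<close> points, at most \<open>4 * N\<close> as
    \<open>N\<close> is positive.\<close>
  also have "\<dots> \<le> (4 * real N) ^ CARD('d) * (K * real N powr (2 * s))"
    using assms(2) by (intro mult_right_mono power_mono) (auto simp: K_def le_max_iff_disj)
  also have "\<dots> = 4 ^ CARD('d) * K * real N powr (real CARD('d) + 2 * s)"
    using assms(2) by (simp add: power_mult_distrib powr_add powr_realpow)
  finally show ?thesis .
qed

section \<open>Growth in \<open>N\<close> against boundedness of the second derivative\<close>

theorem theorem1p4:
  fixes s T :: real
  assumes "s < (real CARD('d::finite) - 3) / 2"
    and "T > 0"
  shows "\<not> (\<exists>S :: 'd dat \<Rightarrow> 'd traj.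
              data_to_sol T s (s - 1/2) S \<and> twice_frechet_at0 T s (s - 1/2) S)"
proof (rule notI, elim exE conjE)
  fix S :: "'d dat \<Rightarrow> 'd traj"
  let ?l = "s - 1/2" and ?d = "real CARD('d)"
  assume S: "data_to_sol T s ?l S" and tw: "twice_frechet_at0 T s ?l S"
  have SC: "\<And>\<phi>. \<phi> \<in> uball s ?l \<Longrightarrow> S \<phi> \<in> CT T s ?l"
    using S by (simp add: data_to_sol_def)
  obtain B where B: "bdd_bilin T s ?l B" and
    B2: "\<forall>\<phi>\<in>Hsp s ?l. \<forall>t\<in>{0..T}. \<forall>k a C. \<forall>x0>0.
      (\<forall>x. 0 < x \<longrightarrow> x \<le> x0 \<longrightarrow> cmod (vel k (S (dscale x \<phi>) t) - of_real (x\<^sup>2) * a) \<le> C * x ^ 4) \<longrightarrow>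
      vel k (B \<phi> \<phi> t) = 2 * a"
    using twice_frechet_coefficient[OF assms(2) SC tw] by blast
  obtain C where C: "\<And>x h. x \<in> Hsp s ?l \<Longrightarrow> h \<in> Hsp s ?l \<Longrightarrow>
      CTnorm T s ?l (B x h) \<le> C * Hnorm s ?l x * Hnorm s ?l h"
    using B unfolding bdd_bilin_def by blast
  define K where "K = max 1 ((17 * ?d) powr s)"
  define \<kappa> where "\<kappa> = min 1 ((17 * ?d) powr (s - 3/2))"
  have pos: "0 < K" "0 < \<kappa>"
    by (auto simp: K_def \<kappa>_def less_max_iff_disj)
  \<comment> \<open>The 400 is the square of the 20 in the velocity bound, \<open>\<kappa>\<close>
    the lower weight constant, and \<open>4 ^ CARD('d) * K\<close> comes from the squared data
    norm.\<close>
  define M where "M = 400 * (C\<^sup>2 * (4 ^ CARD('d) * K)\<^sup>2) / \<kappa>"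
  have bound: "real N powr (?d - 3 - 2 * s) \<le> M" if N: "0 < N" and NT: "1 / (20 * ?d * (real N)\<^sup>2) \<le> T" for N
  proof -
    define t where "t = 1 / (20 * ?d * (real N)\<^sup>2)"
    define u0 :: "'d fc" where "u0 = indicator (lattice_box N (4 * N))"
    define \<phi> :: "'d dat" where "\<phi> = (u0, \<lambda>k. 0, \<lambda>k. 0)"
    have t: "t \<in> {0..T}"
      using NT by (simp add: t_def)
    have fin: "finite {k. u0 k \<noteq> 0}"
      by (rule finite_subset[OF _ finite_lattice_box[of N "4 * N"]]) (auto simp: u0_def indicator_def split: if_splits)
    have \<phi>: "\<phi> \<in> Hsp s ?l"
      unfolding \<phi>_def by (rule Hsp_finite_support[OF fin])
    \<comment> \<open>The second derivative is twice the quadratic coefficient, which turns 1/40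
      into 1/20.\<close>
    have vel: "real N ^ CARD('d) / 20 \<le> cmod (vel k (B \<phi> \<phi> t))" if "k \<in> lattice_box N (2 * N)" for k
      unfolding \<phi>_def second_derivative_velocity[where ?u0.0 = u0 and B = B, OF assms(2) S fin t B2]
      using wave_deriv_lattice_box_lower[OF N that t_def] by (simp add: norm_mult u0_def)
    have bt: "bdd_traj T s ?l (B \<phi> \<phi>)"
      using B \<phi> assms(2) by (intro CT_imp_bdd_traj) (auto simp: bdd_bilin_def bdd_lin_def)
    then have BH: "B \<phi> \<phi> t \<in> Hsp s ?l"
      using t by (simp add: bdd_traj_def)
    let ?m = "snd (snd (B \<phi> \<phi> t))" and ?b = "lattice_box N (2 * N) :: (int ^ 'd) set"
    have N1: "0 < real N" using N by simp
    \<comment> \<open>At least \<open>N ^ CARD('d)\<close> frequencies, each with weight of order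
      \<open>N powr (2 * s - 3)\<close> and squared coefficient of order
      \<open>N ^ (2 * CARD('d))\<close>.\<close>
    have "\<kappa> / 400 * real N powr (3 * ?d + 2 * s - 3)
        = real N ^ CARD('d) * (\<kappa> * real N powr (2 * (s - 3/2)) * (real N ^ CARD('d) / 20)\<^sup>2)"
    proof -
      have "real N powr (3 * ?d + 2 * s - 3) = real N powr ?d * real N powr (2 * (s - 3/2)) * (real N powr ?d)\<^sup>2"
        using N1 by (simp add: power2_eq_square flip: powr_add) (simp add: algebra_simps)
      then show ?thesis
        using N1 by (simp add: powr_realpow power_divide)
    qed
    also have "\<dots> \<le> (\<Sum>k\<in>?b. \<kappa> * real N powr (2 * (s - 3/2)) * (real N ^ CARD('d) / 20)\<^sup>2)"
      using pos by (simp add: card_lattice_box) (intro mult_right_mono power_mono, auto)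
    also have "\<dots> \<le> (\<Sum>k\<in>?b. (1 + ksq k) powr (?l - 1) * (cmod (?m k))\<^sup>2)"
    proof (intro sum_mono mult_mono power_mono)
      fix k :: "int ^ 'd" assume k: "k \<in> ?b"
      moreover have "int (2 * N) \<le> int (4 * N)"
        by simp
      ultimately have "k \<in> lattice_box N (4 * N)"
        unfolding lattice_box_def by (blast intro: order_trans)
      from weight_lattice_box(2)[OF N this, of "s - 3/2"]
      show "\<kappa> * real N powr (2 * (s - 3/2)) \<le> (1 + ksq k) powr (?l - 1)"
        by (simp add: \<kappa>_def)
      show "real N ^ CARD('d) / 20 \<le> cmod (?m k)"
        using vel[OF k] by (simp add: vel_def)
    qed auto
    also have "\<dots> \<le> sob_nsq (?l - 1) ?m"
      unfolding sob_nsq_def using BH by (intro finite_sum_le_infsum) (auto simp: Hsp_def in_sob_def)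
    also have "\<dots> \<le> (Hnorm s ?l (B \<phi> \<phi> t))\<^sup>2"
      unfolding Hnorm_squared by (simp add: sob_nsq_nonneg)
    also have "\<dots> \<le> (C * (Hnorm s ?l \<phi>)\<^sup>2)\<^sup>2"
      using Hnorm_le_CTnorm[OF bt t] C[OF \<phi> \<phi>]
      by (intro power_mono Hnorm_nonneg) (simp add: power2_eq_square mult.assoc)
    also have "\<dots> = C\<^sup>2 * ((Hnorm s ?l \<phi>)\<^sup>2)\<^sup>2"
      by (simp add: power_mult_distrib)
    also have "\<dots> \<le> C\<^sup>2 * (4 ^ CARD('d) * K * real N powr (?d + 2 * s))\<^sup>2"
      using Hnorm_indicator_lattice_box[OF N, of s ?l, where 'd = 'd]
      by (intro mult_left_mono power_mono) (auto simp: \<phi>_def u0_def K_def)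
    finally have *: "\<kappa> / 400 * real N powr (3 * ?d + 2 * s - 3) \<le> C\<^sup>2 * (4 ^ CARD('d) * K * real N powr (?d + 2 * s))\<^sup>2" .
    \<comment> \<open>Splitting off the power carried by the squared upper bound leaves the excess
      exponent \<open>d - 3 - 2 * s\<close>, positive exactly when \<open>s\<close> is below the
      threshold.\<close>
    have "3 * ?d + 2 * s - 3 = (?d - 3 - 2 * s) + ((?d + 2 * s) + (?d + 2 * s))"
      by simp
    then have e: "real N powr (3 * ?d + 2 * s - 3) = real N powr (?d - 3 - 2 * s) * (real N powr (?d + 2 * s))\<^sup>2"
      by (simp only: powr_add power2_eq_square)
    have "\<kappa> / 400 * real N powr (?d - 3 - 2 * s) * (real N powr (?d + 2 * s))\<^sup>2
        \<le> C\<^sup>2 * (4 ^ CARD('d) * K)\<^sup>2 * (real N powr (?d + 2 * s))\<^sup>2"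
      using * unfolding e by (simp add: power_mult_distrib mult_ac)
    then have "\<kappa> / 400 * real N powr (?d - 3 - 2 * s) \<le> C\<^sup>2 * (4 ^ CARD('d) * K)\<^sup>2"
      using N1 by (subst (asm) mult_le_cancel_right_pos) auto
    then show ?thesis
      using pos by (simp add: M_def field_simps)
  qed
  define e where "e = ?d - 3 - 2 * s"
  have e: "0 < e"
    using assms(1) by (simp add: e_def)
  \<comment> \<open>\<open>P powr e\<close> is \<open>max M 1\<close>, so any \<open>N\<close> above
    \<open>P\<close> violates the bound; \<open>N\<close> above \<open>1 / T\<close> keeps the test
    time within \<open>{0..T}\<close>.\<close>
  define P where "P = max M 1 powr (1 / e)"
  obtain N where N: "max (1 / T) P < real N"
    using reals_Archimedean2 by blast
  then have NT: "1 / T < real N" and NP: "P < real N"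
    by simp_all
  have "0 < real N"
    using NT assms(2) by (smt (verit) divide_pos_pos)
  then have N0: "0 < N" by simp
  have "1 \<le> ?d"
    by simp
  then have "1 \<le> real N" "1 \<le> 20 * ?d"
    using N0 by linarith+
  then have "1 * (1 * real N) \<le> 20 * ?d * (real N * real N)"
    by (intro mult_mono) auto
  then have "1 / (20 * ?d * (real N)\<^sup>2) \<le> 1 / real N"
    using N0 by (intro divide_left_mono) (auto simp: power2_eq_square)
  also have "\<dots> \<le> T"
    using NT N0 assms(2) by (simp add: field_simps)
  finally have "real N powr e \<le> M"
    using bound[OF N0] by (simp add: e_def)
  moreover have "max M 1 = P powr e"
    using e by (simp add: P_def powr_powr)
  moreover have "P powr e < real N powr e"
    using NP e by (intro powr_less_mono2) (auto simp: P_def)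
  ultimately show False by simp
qed

end
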